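(* Let $n\geq 2$, $m\geq 1$ and let $p$ be a positive divisor of $m$; let $G=G(m,p,n)$. Then $$\dim Y_G=n\left(m\frac{n-1}{2}+\frac{m}{p}-1\right),$$ and the rank of the Fomin--Kirillov Nichols algebra $\mathcal{B}_G$ and the simple Yetter--Drinfeld (YD) summands of $Y_G$ are as follows. (i) If $n\geq 3$, the rank of $\mathcal{B}_G$ is $m/p$. There is one simple YD summand of dimension $mn(n-1)/2$, spanned by the $r_s$ for the order two reflections $s=\theta^k(ij)$. For each divisor $d>1$ of $m/p$ there are $\varphi(d)$ simple YD summands of dimension $n$, spanned by $\{r_s\mid s=s_i^k,\ i=1,\ldots,n\}$, one for each $k$ of (additive) order $d$ modulo $m$. (ii) If $n=2$ and $p$ is odd, then the same description as in (i) applies. (iii) If $n=2$ and $p=2b$ is even, write $m=2a$. Then $\mathcal{B}_G$ for $G=G(2a,2b,2)$ has rank $a/b+1$. The YD submodule spanned by the $r_s$ for the order two reflections $s=\theta^k(12)$ splits as a direct sum of two simple submodules $V^{\mathrm{odd}}\oplus V^{\mathrm{even}}$, where $V^{\mathrm{even}}$ is spanned by $\{r_s\mid s=\theta^{2k}(12),\ k=0,\ldots,a-1\}$ and $V^{\mathrm{odd}}$ is spanned by $\{r_s\mid s=\theta^{2k+1}(12),\ k=0,\ldots,a-1\}$.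
   Context: Let $k$ be a field of characteristic zero containing a primitive $m$-th root of unity $\theta$. $G(m,p,n)$ is the group of linear transformations of $V=k^n$ (basis $x_1,\ldots,x_n$, dual basis $y_1,\ldots,y_n$ of $V^*$) of the form $x_i\mapsto\theta^{\nu_i}x_{\sigma(i)}$ with $\sigma\in S_n$ and $\sum_i\nu_i\equiv 0\bmod p$. It is a complex reflection group. Its set of reflections $\mathcal{S}_G$ (elements $s$ such that $1-s$ has rank one) consists of: - $s_i^k$ for $1\leq i\leq n$ and $k\not\equiv 0\bmod m$ divisible by $p$ ($k$ taken modulo $m$), where $s_i^k$ maps $x_i\mapsto\theta^kx_i$ and fixes the other $x_j$; - $\theta^k(ij)$ for $i<j$ and $k$ modulo $m$, which maps $x_i\mapsto\theta^kx_j$, $x_j\mapsto\theta^{-k}x_i$ and fixes the other $x_l$. Roots $\alpha_s^*\in V^*$ are chosen as $\alpha^*_{s_i^k}=y_i$ and $\alpha^*_{\theta^k(ij)}=y_i-\theta^{-k}y_j$ ($i<j$). With $G$ acting on $V^*$ contragrediently, scalars $\lambda(g,s)\in k^\times$ ($g\in G$, $s\in\mathcal{S}_G$) are defined by $g\triangleright\alpha_s^*=\lambda(g,s)\,\alpha^*_{gsg^{-1}}$. The Yetter--Drinfeld module $Y_G$ over $kG$ has basis $\{r_s\mid s\in\mathcal{S}_G\}$, coaction $\delta(r_s)=s\otimes r_s$ and action $g\triangleright r_s=\lambda(g,s)\,r_{gsg^{-1}}$. Its braiding is $\Psi_G(r_s\otimes r_t)=(s\triangleright r_t)\otimes r_s$.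 The Fomin--Kirillov Nichols algebra of $G$ is the Nichols algebra $\mathcal{B}_G:=\mathcal{B}(Y_G)$. The rank of $\mathcal{B}_G$ (or of $Y_G$) is the number of simple summands in the decomposition of $Y_G$ into a direct sum of simple Yetter--Drinfeld modules. $\varphi$ is Euler's totient function. *)

theory Defs
  imports
    "Jordan_Normal_Form.DL_Rank"
    "HOL-Algebra.Elementary_Groups"
    "HOL-Algebra.Multiplicative_Group"
    "HOL-Library.Poly_Mapping"
    "HOL-Library.FuncSet"
    "HOL-Combinatorics.Permutations"
    "HOL-Number_Theory.Totient"
begin

section \<open>Yetter--Drinfeld modules over a group algebra\<close>

text \<open>
  The carrier \<open>M\<close> is a subspace of an ambient vector space \<open>'v\<close>. An element
  \<open>\<Sum>g. g \<otimes> v\<^sub>g\<close> of \<open>kG \<otimes> M\<close> is represented by the finitely supported function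
  \<open>g \<mapsto> v\<^sub>g\<close>, so the coaction has type \<open>'v \<Rightarrow> ('g \<Rightarrow>\<^sub>0 'v)\<close>.
  Outside of \<open>carrier G\<close> and \<open>M\<close> nothing is required of the action and the coaction.
\<close>

locale yetter_drinfeld_module = group G + vector_space scale
  for G :: "('g, 'b) monoid_scheme" (structure)
    and scale :: "'k::field \<Rightarrow> 'v::ab_group_add \<Rightarrow> 'v" +
  fixes act :: "'g \<Rightarrow> 'v \<Rightarrow> 'v"
    and coact :: "'v \<Rightarrow> ('g \<Rightarrow>\<^sub>0 'v)"
    and M :: "'v set"
  assumes subspace_M: "Modules.module.subspace scale M"
    and act_closed: "g \<in> carrier G \<Longrightarrow> v \<in> M \<Longrightarrow> act g v \<in> M"
    and act_add: "g \<in> carrier G \<Longrightarrow> v \<in> M \<Longrightarrow> w \<in> M \<Longrightarrow> act g (v + w) = act g v + act g w"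
    and act_scale: "g \<in> carrier G \<Longrightarrow> v \<in> M \<Longrightarrow> act g (scale c v) = scale c (act g v)"
    and act_one: "v \<in> M \<Longrightarrow> act \<one> v = v"
    and act_mult: "g \<in> carrier G \<Longrightarrow> h \<in> carrier G \<Longrightarrow> v \<in> M \<Longrightarrow>
          act (g \<otimes> h) v = act g (act h v)"
    and coact_keys: "v \<in> M \<Longrightarrow> Poly_Mapping.keys (coact v) \<subseteq> carrier G"
    and coact_closed: "v \<in> M \<Longrightarrow> Poly_Mapping.lookup (coact v) g \<in> M"
    and coact_add: "v \<in> M \<Longrightarrow> w \<in> M \<Longrightarrow> coact (v + w) = coact v + coact w"
    and coact_scale: "v \<in> M \<Longrightarrow> Poly_Mapping.lookup (coact (scale c v)) g =
          scale c (Poly_Mapping.lookup (coact v) g)"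
    and counit: "v \<in> M \<Longrightarrow> (\<Sum>g\<in>Poly_Mapping.keys (coact v).
          Poly_Mapping.lookup (coact v) g) = v"
    \<comment> \<open>\<open>(\<Delta> \<otimes> id) \<delta> = (id \<otimes> \<delta>) \<delta>\<close>, where \<open>\<Delta> g = g \<otimes> g\<close>\<close>
    and coassoc: "v \<in> M \<Longrightarrow> coact (Poly_Mapping.lookup (coact v) g) =
          Poly_Mapping.single g (Poly_Mapping.lookup (coact v) g)"
    \<comment> \<open>\<open>\<delta>(g \<triangleright> v) = \<Sum>h. g h g\<^sup>-\<^sup>1 \<otimes> (g \<triangleright> v\<^sub>h)\<close>\<close>
    and yetter_drinfeld: "g \<in> carrier G \<Longrightarrow> h \<in> carrier G \<Longrightarrow> v \<in> M \<Longrightarrow>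
          Poly_Mapping.lookup (coact (act g v)) (g \<otimes> h \<otimes> inv g) =
          act g (Poly_Mapping.lookup (coact v) h)"
begin

text \<open>Stability under the coaction means \<open>\<delta>(U) \<subseteq> kG \<otimes> U\<close>.\<close>

definition submodule :: "'v set \<Rightarrow> bool" where
  "submodule U \<longleftrightarrow> U \<subseteq> M \<and> Modules.module.subspace scale U \<and>
     (\<forall>g\<in>carrier G. \<forall>u\<in>U. act g u \<in> U) \<and> (\<forall>u\<in>U. \<forall>g. Poly_Mapping.lookup (coact u) g \<in> U)"

definition simple_submodule :: "'v set \<Rightarrow> bool" where
  "simple_submodule U \<longleftrightarrow> submodule U \<and> U \<noteq> {0} \<and>
     (\<forall>W. submodule W \<and> W \<subseteq> U \<longrightarrow> W = {0} \<or> W = U)"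

end

text \<open>\<open>W\<close> is the internal direct sum of the finitely many subspaces in \<open>D\<close>: the addition map
  from the external direct sum is a bijection onto \<open>W\<close>.\<close>

definition internal_direct_sum :: "'v::ab_group_add set set \<Rightarrow> 'v set \<Rightarrow> bool" where
  "internal_direct_sum D W \<longleftrightarrow>
     finite D \<and> bij_betw (\<lambda>u. \<Sum>U\<in>D. u U) (\<Pi>\<^sub>E U\<in>D. U) W"

context yetter_drinfeld_module
begin

text \<open>Simple summands of an internal direct sum are pairwise distinct, so a set of
  submodules suffices to describe the decomposition.\<close>

definition simple_decomposition :: "'v set set \<Rightarrow> bool" where
  "simple_decomposition D \<longleftrightarrow> (\<forall>U\<in>D. simple_submodule U) \<and> internal_direct_sum D M"

text \<open>Well defined by the Krull--Schmidt theorem.\<close>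

definition rank :: nat where
  "rank = (THE r. \<exists>D. simple_decomposition D \<and> card D = r)"

end

section \<open>The groups $G(m,p,n)$\<close>

text \<open>
  The basis \<open>x\<^sub>1, \<dots>, x\<^sub>n\<close> of \<open>V = k\<^sup>n\<close> is \<open>unit_vec n 0, \<dots>, unit_vec n (n - 1)\<close>; covectors are
  represented by their coordinates with respect to the dual basis, which is therefore also
  given by the unit vectors. Linear endomorphisms of \<open>V\<close> are \<open>n \<times> n\<close> matrices acting on columns.
\<close>

definition primitive_root_of_unity :: "nat \<Rightarrow> 'k::field \<Rightarrow> bool" where
  "primitive_root_of_unity m \<theta> \<longleftrightarrow> \<theta> ^ m = 1 \<and> (\<forall>d. 0 < d \<and> d < m \<longrightarrow> \<theta> ^ d \<noteq> 1)"

definition endo :: "nat \<Rightarrow> (nat \<Rightarrow> 'k::field vec) \<Rightarrow> 'k mat" where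
  "endo n f = mat_of_cols n (map f [0..<n])" \<comment> \<open>\<open>x\<^sub>l \<mapsto> f l\<close>\<close>

definition reflection_group :: "nat \<Rightarrow> nat \<Rightarrow> nat \<Rightarrow> 'k::field \<Rightarrow> 'k mat monoid" where
  "reflection_group m p n \<theta> =
     \<lparr>carrier = {endo n (\<lambda>i. \<theta> ^ \<nu> i \<cdot>\<^sub>v unit_vec n (\<sigma> i)) | \<sigma> \<nu>.
                  \<sigma> permutes {..<n} \<and> (\<forall>i<n. \<nu> i < m) \<and> p dvd (\<Sum>i<n. \<nu> i)},
      monoid.mult = (*), one = 1\<^sub>m n\<rparr>"

definition reflections :: "nat \<Rightarrow> nat \<Rightarrow> nat \<Rightarrow> 'k::field \<Rightarrow> 'k mat set" where
  "reflections m p n \<theta> =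
     {s \<in> carrier (reflection_group m p n \<theta>). vec_space.rank n (1\<^sub>m n - s) = 1}"

text \<open>The reflections \<open>s\<^sub>i\<^sup>k\<close> and \<open>\<theta>\<^sup>k(ij)\<close>.\<close>

definition diag_refl :: "nat \<Rightarrow> 'k::field \<Rightarrow> nat \<Rightarrow> nat \<Rightarrow> 'k mat" where
  "diag_refl n \<theta> i k =
     endo n (\<lambda>l. if l = i then \<theta> ^ k \<cdot>\<^sub>v unit_vec n i else unit_vec n l)"

definition swap_refl :: "nat \<Rightarrow> 'k::field \<Rightarrow> nat \<Rightarrow> nat \<Rightarrow> nat \<Rightarrow> 'k mat" where
  "swap_refl n \<theta> i j k =
     endo n (\<lambda>l. if l = i then \<theta> ^ k \<cdot>\<^sub>v unit_vec n j
                 else if l = j then inverse (\<theta> ^ k) \<cdot>\<^sub>v unit_vec n i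
                 else unit_vec n l)"

definition swap_refls :: "nat \<Rightarrow> nat \<Rightarrow> 'k::field \<Rightarrow> 'k mat set" where
  "swap_refls m n \<theta> = {swap_refl n \<theta> i j k | i j k. i < j \<and> j < n \<and> k < m}"

section \<open>The Yetter--Drinfeld module $Y_G$\<close>

text \<open>On reflections the description determines \<open>\<alpha>\<^sub>s\<^sup>*\<close> uniquely; elsewhere the value is irrelevant.
  As \<open>p\<close> divides \<open>m\<close>, the exponents may be taken below \<open>m\<close>.\<close>

definition refl_root :: "nat \<Rightarrow> nat \<Rightarrow> nat \<Rightarrow> 'k::field \<Rightarrow> 'k mat \<Rightarrow> 'k vec" where
  "refl_root m p n \<theta> s = (THE \<alpha>.
     (\<exists>i k. i < n \<and> 0 < k \<and> k < m \<and> p dvd k \<and> s = diag_refl n \<theta> i k \<and> \<alpha> = unit_vec n i) \<or>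
     (\<exists>i j k. i < j \<and> j < n \<and> k < m \<and> s = swap_refl n \<theta> i j k \<and>
        \<alpha> = unit_vec n i - inverse (\<theta> ^ k) \<cdot>\<^sub>v unit_vec n j))"

text \<open>\<open>(g \<triangleright> f)(v) = f(g\<^sup>-\<^sup>1 v)\<close>\<close>

definition contragredient ::
  "nat \<Rightarrow> nat \<Rightarrow> nat \<Rightarrow> 'k::field \<Rightarrow> 'k mat \<Rightarrow> 'k vec \<Rightarrow> 'k vec" where
  "contragredient m p n \<theta> g f = transpose_mat (inv\<^bsub>reflection_group m p n \<theta>\<^esub> g) *\<^sub>v f"

definition conjugate_by :: "nat \<Rightarrow> nat \<Rightarrow> nat \<Rightarrow> 'k::field \<Rightarrow> 'k mat \<Rightarrow> 'k mat \<Rightarrow> 'k mat" where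
  "conjugate_by m p n \<theta> g s = g * s * inv\<^bsub>reflection_group m p n \<theta>\<^esub> g"

definition lam :: "nat \<Rightarrow> nat \<Rightarrow> nat \<Rightarrow> 'k::field \<Rightarrow> 'k mat \<Rightarrow> 'k mat \<Rightarrow> 'k" where
  "lam m p n \<theta> g s = (THE c. contragredient m p n \<theta> g (refl_root m p n \<theta> s) =
                        c \<cdot>\<^sub>v refl_root m p n \<theta> (conjugate_by m p n \<theta> g s))"

text \<open>\<open>Y\<^sub>G\<close> is the free vector space on the reflections, inside the free vector space on all matrices.\<close>

definition pm_scale :: "'k::field \<Rightarrow> ('a \<Rightarrow>\<^sub>0 'k) \<Rightarrow> ('a \<Rightarrow>\<^sub>0 'k)" where
  "pm_scale c = Poly_Mapping.map ((*) c)"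

definition rvec :: "'k::field mat \<Rightarrow> ('k mat \<Rightarrow>\<^sub>0 'k)" where
  "rvec s = Poly_Mapping.single s 1"

abbreviation pm_span :: "('a \<Rightarrow>\<^sub>0 'k::field) set \<Rightarrow> ('a \<Rightarrow>\<^sub>0 'k) set" where
  "pm_span \<equiv> Modules.module.span pm_scale"

abbreviation pm_dim :: "('a \<Rightarrow>\<^sub>0 'k::field) set \<Rightarrow> nat" where
  "pm_dim \<equiv> Vector_Spaces.vector_space.dim pm_scale"

definition Y_space :: "nat \<Rightarrow> nat \<Rightarrow> nat \<Rightarrow> 'k::field \<Rightarrow> ('k mat \<Rightarrow>\<^sub>0 'k) set" where
  "Y_space m p n \<theta> = {f. Poly_Mapping.keys f \<subseteq> reflections m p n \<theta>}"

text \<open>The linear extensions of \<open>g \<triangleright> r\<^sub>s = \<lambda>(g, s) r\<^bsub>gsg\<^sup>-\<^sup>1\<^esub>\<close> and \<open>\<delta>(r\<^sub>s) = s \<otimes> r\<^sub>s\<close>.\<close>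

definition Y_act ::
  "nat \<Rightarrow> nat \<Rightarrow> nat \<Rightarrow> 'k::field \<Rightarrow> 'k mat \<Rightarrow> ('k mat \<Rightarrow>\<^sub>0 'k) \<Rightarrow> ('k mat \<Rightarrow>\<^sub>0 'k)" where
  "Y_act m p n \<theta> g f = (\<Sum>s\<in>Poly_Mapping.keys f.
     pm_scale (Poly_Mapping.lookup f s * lam m p n \<theta> g s) (rvec (conjugate_by m p n \<theta> g s)))"

definition Y_coact :: "('k::field mat \<Rightarrow>\<^sub>0 'k) \<Rightarrow> ('k mat \<Rightarrow>\<^sub>0 ('k mat \<Rightarrow>\<^sub>0 'k))" where
  "Y_coact f = (\<Sum>s\<in>Poly_Mapping.keys f.
     Poly_Mapping.single s (pm_scale (Poly_Mapping.lookup f s) (rvec s)))"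

abbreviation Y_is_yetter_drinfeld :: "nat \<Rightarrow> nat \<Rightarrow> nat \<Rightarrow> 'k::field \<Rightarrow> bool" where
  "Y_is_yetter_drinfeld m p n \<theta> \<equiv>
     yetter_drinfeld_module (reflection_group m p n \<theta>) pm_scale
       (Y_act m p n \<theta>) Y_coact (Y_space m p n \<theta>)"

abbreviation Y_submodule ::
  "nat \<Rightarrow> nat \<Rightarrow> nat \<Rightarrow> 'k::field \<Rightarrow> ('k mat \<Rightarrow>\<^sub>0 'k) set \<Rightarrow> bool" where
  "Y_submodule m p n \<theta> \<equiv>
     yetter_drinfeld_module.submodule (reflection_group m p n \<theta>) pm_scale
       (Y_act m p n \<theta>) Y_coact (Y_space m p n \<theta>)"

abbreviation Y_simple_submodule ::
  "nat \<Rightarrow> nat \<Rightarrow> nat \<Rightarrow> 'k::field \<Rightarrow> ('k mat \<Rightarrow>\<^sub>0 'k) set \<Rightarrow> bool" where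
  "Y_simple_submodule m p n \<theta> \<equiv>
     yetter_drinfeld_module.simple_submodule (reflection_group m p n \<theta>) pm_scale
       (Y_act m p n \<theta>) Y_coact (Y_space m p n \<theta>)"

abbreviation Y_simple_decomposition ::
  "nat \<Rightarrow> nat \<Rightarrow> nat \<Rightarrow> 'k::field \<Rightarrow> ('k mat \<Rightarrow>\<^sub>0 'k) set set \<Rightarrow> bool" where
  "Y_simple_decomposition m p n \<theta> \<equiv>
     yetter_drinfeld_module.simple_decomposition (reflection_group m p n \<theta>) pm_scale
       (Y_act m p n \<theta>) Y_coact (Y_space m p n \<theta>)"

text \<open>The rank of the Fomin--Kirillov Nichols algebra \<open>\<B>(Y\<^sub>G)\<close> is by definition that of \<open>Y\<^sub>G\<close>.\<close>

definition nichols_rank :: "nat \<Rightarrow> nat \<Rightarrow> nat \<Rightarrow> 'k::field \<Rightarrow> nat" where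
  "nichols_rank m p n \<theta> =
     yetter_drinfeld_module.rank (reflection_group m p n \<theta>) pm_scale
       (Y_act m p n \<theta>) Y_coact (Y_space m p n \<theta>)"

text \<open>The exponents \<open>k\<close> modulo \<open>m\<close> of additive order \<open>d\<close>, and the span of
  \<open>r\<^sub>s\<close> for \<open>s = s\<^sub>i\<^sup>k\<close>, \<open>i = 1, \<dots>, n\<close>.\<close>

definition exponents_of_order :: "nat \<Rightarrow> nat \<Rightarrow> nat set" where
  "exponents_of_order m d = {k. k < m \<and> group.ord (integer_mod_group m) (int k) = d}"

definition diag_summand :: "nat \<Rightarrow> 'k::field \<Rightarrow> nat \<Rightarrow> ('k mat \<Rightarrow>\<^sub>0 'k) set" where
  "diag_summand n \<theta> k = pm_span {rvec (diag_refl n \<theta> i k) | i. i < n}"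

definition diag_summands :: "nat \<Rightarrow> nat \<Rightarrow> nat \<Rightarrow> 'k::field \<Rightarrow> ('k mat \<Rightarrow>\<^sub>0 'k) set set" where
  "diag_summands m p n \<theta> =
     (\<Union>d\<in>{d. d dvd m div p \<and> d > 1}. diag_summand n \<theta> ` exponents_of_order m d)"

definition swap_summand :: "nat \<Rightarrow> nat \<Rightarrow> 'k::field \<Rightarrow> ('k mat \<Rightarrow>\<^sub>0 'k) set" where
  "swap_summand m n \<theta> = pm_span (rvec ` swap_refls m n \<theta>)"

text \<open>For \<open>n = 2\<close> and \<open>m = 2a\<close>: the spans of \<open>r\<^sub>s\<close> for \<open>s = \<theta>\<^sup>2\<^sup>k(12)\<close> and for
  \<open>s = \<theta>\<^sup>2\<^sup>k\<^sup>+\<^sup>1(12)\<close>, \<open>0 \<le> k < a\<close>.\<close>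

definition V_even :: "nat \<Rightarrow> 'k::field \<Rightarrow> ('k mat \<Rightarrow>\<^sub>0 'k) set" where
  "V_even a \<theta> = pm_span {rvec (swap_refl 2 \<theta> 0 1 (2 * k)) | k. k < a}"

definition V_odd :: "nat \<Rightarrow> 'k::field \<Rightarrow> ('k mat \<Rightarrow>\<^sub>0 'k) set" where
  "V_odd a \<theta> = pm_span {rvec (swap_refl 2 \<theta> 0 1 (2 * k + 1)) | k. k < a}"

end

theory Submission
  imports Defs
begin

text \<open>
  The coaction of \<open>Y\<^sub>G\<close> has one-dimensional homogeneous components, spanned by the basis vectors
  \<open>r\<^sub>s\<close>. A submodule contains the homogeneous components of its elements, so it is spanned by the
  \<open>r\<^sub>s\<close> in it, and as the scalars \<open>\<lambda>(g, s)\<close> do not vanish, its set of indices is stable under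
  conjugation (\<open>submodule_iff\<close>). Hence the simple submodules are the spans of the conjugacy classes
  of reflections, \<open>Y\<^sub>G\<close> is their direct sum, no other decomposition into simple submodules
  exists, and the rank is the number of classes (\<open>simple_decomposition_conj_classes\<close>). This holds for any
  cocycle on a union of conjugacy classes, and is developed in that generality.

  That the \<open>\<lambda>(g, s)\<close> exist and form a cocycle follows from a description of roots without
  coordinates: \<open>s\<close> is a reflection if \<open>1 - s\<close> is an outer product \<open>u \<alpha>\<^sup>T \<noteq> 0\<close>, and then \<open>\<alpha>\<close> is
  unique up to a scalar. Since \<open>1 - gsg\<^sup>-\<^sup>1 = (gu)(g \<triangleright> \<alpha>)\<^sup>T\<close>, the covector \<open>g \<triangleright> \<alpha>\<^sub>s\<^sup>*\<close> is a
  multiple of the chosen root of \<open>gsg\<^sup>-\<^sup>1\<close> (\<open>root_of_conjugate\<close>, \<open>lam_spec\<close>).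

  It remains to find the reflections and their classes. The elements of the group are the monomial
  matrices whose coefficients are powers of \<open>\<theta>\<close> and have a product \<open>z\<close> with \<open>z\<^bsup>m/p\<^esup> = 1\<close>. The
  \<open>2 \<times> 2\<close> minors of \<open>1 - s\<close> leave only the two families of reflections (\<open>reflections_eq\<close>).
  Permutation matrices permute the \<open>s\<^sub>i\<^sup>k\<close> with the same \<open>k\<close>, and \<open>k\<close> is invariant, which gives
  \<open>m/p - 1\<close> classes; those with \<open>k\<close> of order \<open>d\<close> are counted by \<open>\<phi>(d)\<close>. A diagonal matrix with
  coefficients \<open>c\<close> multiplies the coefficient of a swap of \<open>i\<close> and \<open>j\<close> by \<open>c\<^sub>j / c\<^sub>i\<close>. If \<open>n \<ge> 3\<close> or
  \<open>p\<close> is odd, every power of \<open>\<theta>\<close> is such a quotient (\<open>admissible_quotient\<close>) and the swaps form one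
  class. If \<open>n = 2\<close> and \<open>p\<close> is even, the quotients are the even powers of \<open>\<theta>\<close>
  (\<open>admissible_quotient_even\<close>); interchanging the two coordinates inverts the coefficient of a swap,
  which preserves the parity of its exponent as well, and the swaps form two classes.
\<close>

section \<open>Free vector spaces and their coordinate subspaces\<close>

lemma lookup_pm_scale [simp]:
  "Poly_Mapping.lookup (pm_scale c f) x = c * Poly_Mapping.lookup f x"
  by (auto simp: pm_scale_def Poly_Mapping.map.rep_eq when_def)

lemma vector_space_pm_scale: "vector_space (pm_scale :: 'k::field \<Rightarrow> ('a \<Rightarrow>\<^sub>0 'k) \<Rightarrow> _)"
  by unfold_locales (auto intro!: poly_mapping_eqI simp: lookup_add algebra_simps)

interpretation pm: vector_space "pm_scale :: 'k::field \<Rightarrow> ('a \<Rightarrow>\<^sub>0 'k) \<Rightarrow> _"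
  by (rule vector_space_pm_scale)

lemma pm_scale_single [simp]: "pm_scale c (Poly_Mapping.single s d) = Poly_Mapping.single s (c * d)"
  by (auto intro!: poly_mapping_eqI simp: lookup_single when_def)

definition supported :: "'a set \<Rightarrow> ('a \<Rightarrow>\<^sub>0 'k::field) set" where
  "supported A = {f. Poly_Mapping.keys f \<subseteq> A}"

lemma supportedI: "(\<And>s. s \<notin> A \<Longrightarrow> Poly_Mapping.lookup f s = 0) \<Longrightarrow> f \<in> supported A"
  by (auto simp: supported_def in_keys_iff)

lemma lookup_supported: "f \<in> supported A \<Longrightarrow> s \<notin> A \<Longrightarrow> Poly_Mapping.lookup f s = 0"
  by (auto simp: supported_def in_keys_iff)

lemma single_in_supported [simp]:
  "Poly_Mapping.single s (1 :: 'k::field) \<in> supported A \<longleftrightarrow> s \<in> A"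
  by (simp add: supported_def)

lemma supported_eq_iff [simp]: "(supported A :: ('a \<Rightarrow>\<^sub>0 'k::field) set) = supported B \<longleftrightarrow> A = B"
proof
  assume eq: "supported A = (supported B :: ('a \<Rightarrow>\<^sub>0 'k) set)"
  have "s \<in> A \<longleftrightarrow> s \<in> B" for s
    using single_in_supported[of s A, where 'k = 'k] single_in_supported[of s B, where 'k = 'k] eq by simp
  then show "A = B" by blast
qed simp

lemma supported_subset_iff [simp]:
  "(supported A :: ('a \<Rightarrow>\<^sub>0 'k::field) set) \<subseteq> supported B \<longleftrightarrow> A \<subseteq> B"
proof
  assume sub: "supported A \<subseteq> (supported B :: ('a \<Rightarrow>\<^sub>0 'k) set)"
  show "A \<subseteq> B"
  proof
    fix s assume "s \<in> A"
    then have "Poly_Mapping.single s (1 :: 'k) \<in> supported A" by simp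
    then have "Poly_Mapping.single s (1 :: 'k) \<in> supported B" using sub by blast
    then show "s \<in> B" by simp
  qed
qed (auto simp: supported_def)

lemma supported_eq_0_iff: "(supported A :: ('a \<Rightarrow>\<^sub>0 'k::field) set) = {0} \<longleftrightarrow> A = {}"
proof -
  have "supported {} = {0 :: 'a \<Rightarrow>\<^sub>0 'k}"
    by (auto simp: supported_def)
  then show ?thesis
    using supported_eq_iff[of A "{}", where 'k = 'k] by simp
qed

lemma inj_supported: "inj_on (supported :: 'a set \<Rightarrow> ('a \<Rightarrow>\<^sub>0 'k::field) set) \<A>"
  by (simp add: inj_on_def)

lemma subspace_supported: "pm.subspace (supported A :: ('a \<Rightarrow>\<^sub>0 'k::field) set)"
  by (rule pm.subspaceI)
     (auto intro!: supportedI simp: lookup_add lookup_supported)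

lemma sum_of_coordinates:
  "(\<Sum>s\<in>Poly_Mapping.keys f. Poly_Mapping.single s (Poly_Mapping.lookup f s)) = f"
  by (rule poly_mapping_eqI) (auto simp: lookup_sum lookup_single when_def in_keys_iff sum.delta)

lemma subspace_contains_supported:
  assumes U: "pm.subspace U" and singles: "\<And>s. s \<in> A \<Longrightarrow> Poly_Mapping.single s (1 :: 'k::field) \<in> U"
  shows "supported A \<subseteq> U"
proof
  fix f :: "'a \<Rightarrow>\<^sub>0 'k" assume f: "f \<in> supported A"
  have "pm_scale (Poly_Mapping.lookup f s) (Poly_Mapping.single s 1) \<in> U"
    if "s \<in> Poly_Mapping.keys f" for s
    using that f by (intro pm.subspace_scale[OF U] singles) (auto simp: supported_def)
  then have "(\<Sum>s\<in>Poly_Mapping.keys f. Poly_Mapping.single s (Poly_Mapping.lookup f s)) \<in> U"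
    by (intro pm.subspace_sum[OF U]) simp
  then show "f \<in> U"
    by (simp only: sum_of_coordinates)
qed

lemma span_singles:
  "pm_span ((\<lambda>s. Poly_Mapping.single s (1 :: 'k::field)) ` A) = supported A"
proof
  show "pm_span ((\<lambda>s. Poly_Mapping.single s (1 :: 'k)) ` A) \<subseteq> supported A"
    by (rule pm.span_minimal) (auto simp: subspace_supported)
  show "supported A \<subseteq> pm_span ((\<lambda>s. Poly_Mapping.single s (1 :: 'k)) ` A)"
    by (rule subspace_contains_supported) (auto intro: pm.span_base)
qed

lemma dim_supported:
  assumes "finite A"
  shows "pm_dim (supported A :: ('a \<Rightarrow>\<^sub>0 'k::field) set) = card A"
proof -
  let ?e = "\<lambda>s. Poly_Mapping.single s (1 :: 'k)"
  have inj: "inj_on ?e A"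
    by (auto intro!: inj_onI dest!: arg_cong[where f = Poly_Mapping.keys])
  have "pm.independent (?e ` A)"
  proof (rule pm.independent_if_scalars_zero)
    show "finite (?e ` A)" using assms by simp
    fix f x assume sum0: "(\<Sum>x\<in>?e ` A. pm_scale (f x) x) = 0" and "x \<in> ?e ` A"
    then obtain s where s: "s \<in> A" "x = ?e s" by blast
    have "0 = Poly_Mapping.lookup (\<Sum>x\<in>?e ` A. pm_scale (f x) x) s"
      using sum0 by simp
    also have "\<dots> = (\<Sum>t\<in>A. f (?e t) * (1 when t = s))"
      by (auto simp: sum.reindex[OF inj] lookup_sum lookup_single when_def intro: sum.cong)
    also have "\<dots> = f x"
      using s assms by (simp add: when_def if_distrib cong: if_cong)
    finally show "f x = 0" by simp
  qed
  then show ?thesis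
    using card_image[OF inj] pm.dim_span_eq_card_independent[of "?e ` A"] by (simp add: span_singles)
qed

text \<open>Each index lies in one member of the family, so the coordinates of a sum can be read off from
  its components.\<close>

lemma internal_direct_sum_supported:
  assumes "finite \<A>" and disj: "\<And>A B. A \<in> \<A> \<Longrightarrow> B \<in> \<A> \<Longrightarrow> A \<noteq> B \<Longrightarrow> A \<inter> B = {}"
  shows "internal_direct_sum (supported ` \<A>) (supported (\<Union>\<A>) :: ('a \<Rightarrow>\<^sub>0 'k::field) set)"
proof -
  let ?D = "supported ` \<A> :: ('a \<Rightarrow>\<^sub>0 'k) set set"
  let ?P = "\<Pi>\<^sub>E U\<in>?D. U"
  have in_U: "u (supported A) \<in> supported A" if "u \<in> ?P" "A \<in> \<A>" for u A
    using that by (auto dest: PiE_mem)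
  have coord: "Poly_Mapping.lookup (\<Sum>U\<in>?D. u U) s = Poly_Mapping.lookup (u (supported A)) s"
    if u: "u \<in> ?P" and A: "A \<in> \<A>" and s: "s \<in> A" for u A s
  proof -
    have "Poly_Mapping.lookup (\<Sum>U\<in>?D. u U) s =
        (\<Sum>B\<in>\<A>. Poly_Mapping.lookup (u (supported B)) s)"
      by (simp add: sum.reindex[OF inj_supported] lookup_sum)
    also have "\<dots> = (\<Sum>B\<in>{A}. Poly_Mapping.lookup (u (supported B)) s)"
    proof (intro sum.mono_neutral_right ballI)
      fix B assume B: "B \<in> \<A> - {A}"
      then have "s \<notin> B" using disj[of A B] A s by auto
      then show "Poly_Mapping.lookup (u (supported B)) s = 0"
        using in_U[OF u, of B] B by (auto intro: lookup_supported)
    qed (use A \<open>finite \<A>\<close> in auto)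
    finally show ?thesis by simp
  qed
  have "inj_on (\<lambda>u. \<Sum>U\<in>?D. u U) ?P"
  proof (rule inj_onI)
    fix u u' assume u: "u \<in> ?P" "u' \<in> ?P" and eq: "(\<Sum>U\<in>?D. u U) = (\<Sum>U\<in>?D. u' U)"
    show "u = u'"
    proof (rule PiE_ext[OF u])
      fix U assume "U \<in> ?D"
      then obtain A where A: "A \<in> \<A>" "U = supported A" by blast
      show "u U = u' U"
      proof (rule poly_mapping_eqI)
        fix s show "Poly_Mapping.lookup (u U) s = Poly_Mapping.lookup (u' U) s"
        proof (cases "s \<in> A")
          case True
          then show ?thesis
            using coord[OF u(1) A(1)] coord[OF u(2) A(1)] eq A(2) by metis
        next
          case False
          then show ?thesis
            using A in_U u by (metis lookup_supported)
        qed
      qed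
    qed
  qed
  moreover have "(\<Sum>U\<in>?D. u U) \<in> supported (\<Union>\<A>)" if "u \<in> ?P" for u
  proof (rule pm.subspace_sum[OF subspace_supported])
    fix U assume "U \<in> ?D"
    then obtain A where A: "A \<in> \<A>" "U = supported A" by blast
    then have "u U \<in> supported A" using in_U that by auto
    then show "u U \<in> supported (\<Union>\<A>)"
      using A(1) by (auto simp: supported_def)
  qed
  moreover have "f \<in> (\<lambda>u. \<Sum>U\<in>?D. u U) ` ?P" if f: "f \<in> supported (\<Union>\<A>)" for f
  proof
    \<comment> \<open>The component of \<open>f\<close> in \<open>supported A\<close> keeps the coordinates with indices in \<open>A\<close>.\<close>
    define r where "r A = (\<Sum>s\<in>Poly_Mapping.keys f \<inter> A. Poly_Mapping.single s (Poly_Mapping.lookup f s))"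
      for A
    have lookup_r: "Poly_Mapping.lookup (r A) s = (if s \<in> A then Poly_Mapping.lookup f s else 0)" for A s
      by (auto simp: r_def lookup_sum lookup_single when_def in_keys_iff sum.delta)
    define u where "u = (\<lambda>U\<in>?D. r (inv_into \<A> supported U))"
    have u_eq: "u (supported A) = r A" if "A \<in> \<A>" for A
      using that by (simp add: u_def inv_into_f_f[OF inj_supported])
    show u: "u \<in> ?P"
      by (rule PiE_I) (auto simp: u_eq lookup_r intro: supportedI, auto simp: u_def)
    show "f = (\<Sum>U\<in>?D. u U)"
    proof (rule poly_mapping_eqI)
      fix s show "Poly_Mapping.lookup f s = Poly_Mapping.lookup (\<Sum>U\<in>?D. u U) s"
      proof (cases "s \<in> \<Union>\<A>")
        case True
        then obtain A where "A \<in> \<A>" "s \<in> A" by blast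
        then show ?thesis using coord[OF u] by (simp add: u_eq lookup_r)
      next
        case False
        then have "Poly_Mapping.lookup (\<Sum>U\<in>?D. u U) s = 0"
          by (auto simp: sum.reindex[OF inj_supported] lookup_sum u_eq lookup_r)
        then show ?thesis using False f by (simp add: lookup_supported)
      qed
    qed
  qed
  ultimately show ?thesis
    using \<open>finite \<A>\<close> unfolding internal_direct_sum_def bij_betw_def by blast
qed

section \<open>Yetter--Drinfeld modules from a cocycle on a union of conjugacy classes\<close>

text \<open>
  The last two assumptions are exactly what makes \<open>g \<triangleright> r\<^sub>s = c(g, s) r\<^bsub>gsg\<^sup>-\<^sup>1\<^esub>\<close> an action on the
  vector space with basis \<open>r\<^sub>s\<close>; the compatibility with the coaction \<open>r\<^sub>s \<mapsto> s \<otimes> r\<^sub>s\<close> holds by the shape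
  of the action.
\<close>

locale conjugation_cocycle = group G for G :: "('g, 'b) monoid_scheme" (structure) +
  fixes X :: "'g set" and c :: "'g \<Rightarrow> 'g \<Rightarrow> 'k::field"
  assumes X_subset: "X \<subseteq> carrier G"
    and conj_X: "g \<in> carrier G \<Longrightarrow> s \<in> X \<Longrightarrow> g \<otimes> s \<otimes> inv g \<in> X"
    and c_one: "s \<in> X \<Longrightarrow> c \<one> s = 1"
    and c_mult: "g \<in> carrier G \<Longrightarrow> h \<in> carrier G \<Longrightarrow> s \<in> X \<Longrightarrow>
          c (g \<otimes> h) s = c g (h \<otimes> s \<otimes> inv h) * c h s"
begin

definition conj :: "'g \<Rightarrow> 'g \<Rightarrow> 'g" where
  "conj g s = g \<otimes> s \<otimes> inv g"

definition act :: "'g \<Rightarrow> ('g \<Rightarrow>\<^sub>0 'k) \<Rightarrow> ('g \<Rightarrow>\<^sub>0 'k)" where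
  "act g f = (\<Sum>s\<in>Poly_Mapping.keys f.
     pm_scale (Poly_Mapping.lookup f s * c g s) (Poly_Mapping.single (conj g s) 1))"

definition coact :: "('g \<Rightarrow>\<^sub>0 'k) \<Rightarrow> ('g \<Rightarrow>\<^sub>0 ('g \<Rightarrow>\<^sub>0 'k))" where
  "coact f = (\<Sum>s\<in>Poly_Mapping.keys f.
     Poly_Mapping.single s (pm_scale (Poly_Mapping.lookup f s) (Poly_Mapping.single s 1)))"

lemma conj_one: "s \<in> carrier G \<Longrightarrow> conj \<one> s = s"
  by (simp add: conj_def)

lemma conj_mult:
  "g \<in> carrier G \<Longrightarrow> h \<in> carrier G \<Longrightarrow> s \<in> carrier G \<Longrightarrow> conj (g \<otimes> h) s = conj g (conj h s)"
  by (simp add: conj_def inv_mult_group m_assoc)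

lemma conj_inv: "g \<in> carrier G \<Longrightarrow> s \<in> carrier G \<Longrightarrow> conj g (conj (inv g) s) = s"
  "g \<in> carrier G \<Longrightarrow> s \<in> carrier G \<Longrightarrow> conj (inv g) (conj g s) = s"
  using conj_mult[of g "inv g" s] conj_mult[of "inv g" g s] by (simp_all add: conj_one)

lemma conj_closed: "g \<in> carrier G \<Longrightarrow> s \<in> carrier G \<Longrightarrow> conj g s \<in> carrier G"
  by (simp add: conj_def)

lemma conj_in_X: "g \<in> carrier G \<Longrightarrow> s \<in> X \<Longrightarrow> conj g s \<in> X"
  by (simp add: conj_def conj_X)

lemma conj_eqD:
  "g \<in> carrier G \<Longrightarrow> s \<in> carrier G \<Longrightarrow> t \<in> carrier G \<Longrightarrow> conj g s = conj g t \<Longrightarrow> s = t"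
  by (metis conj_inv(2))

lemma lookup_coact [simp]:
  "Poly_Mapping.lookup (coact f) g = Poly_Mapping.single g (Poly_Mapping.lookup f g)"
  by (auto simp: coact_def lookup_sum lookup_single when_def in_keys_iff sum.delta)

lemma keys_coact: "Poly_Mapping.keys (coact f) = Poly_Mapping.keys f"
  by (auto simp: in_keys_iff) (metis lookup_single_eq lookup_zero)+

lemma lookup_act:
  assumes g: "g \<in> carrier G" and f: "f \<in> supported X" and t: "t \<in> carrier G"
  shows "Poly_Mapping.lookup (act g f) (conj g t) = c g t * Poly_Mapping.lookup f t"
proof -
  have keys: "s \<in> carrier G" if "s \<in> Poly_Mapping.keys f" for s
    using that f X_subset by (auto simp: supported_def)
  have "Poly_Mapping.lookup (act g f) (conj g t) =
      (\<Sum>s\<in>Poly_Mapping.keys f. Poly_Mapping.lookup f s * c g s * (1 when conj g s = conj g t))"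
    by (simp add: act_def lookup_sum lookup_single when_def if_distrib cong: if_cong)
  also have "\<dots> = (\<Sum>s\<in>Poly_Mapping.keys f. if s = t then Poly_Mapping.lookup f s * c g s else 0)"
    by (intro sum.cong refl) (use conj_eqD[OF g _ t] keys in \<open>auto simp: when_def\<close>)
  also have "\<dots> = c g t * Poly_Mapping.lookup f t"
    by (simp add: sum.delta in_keys_iff)
  finally show ?thesis .
qed

lemma act_in_supported:
  assumes g: "g \<in> carrier G" and A: "A \<subseteq> X" "\<And>s. s \<in> A \<Longrightarrow> conj g s \<in> A" and f: "f \<in> supported A"
  shows "act g f \<in> supported A"
  unfolding act_def
  by (intro pm.subspace_sum[OF subspace_supported] pm.subspace_scale[OF subspace_supported])
     (use A f in \<open>auto simp: supported_def\<close>)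

text \<open>The action is easiest to describe at indices of the form \<open>g t g\<^sup>-\<^sup>1\<close>, and these exhaust \<open>X\<close>.\<close>

lemma coordinates_eqI:
  assumes g: "g \<in> carrier G" and f: "f \<in> supported X" "f' \<in> supported X"
    and eq: "\<And>t. t \<in> X \<Longrightarrow> Poly_Mapping.lookup f (conj g t) = Poly_Mapping.lookup f' (conj g t)"
  shows "f = f'"
proof (rule poly_mapping_eqI)
  fix t show "Poly_Mapping.lookup f t = Poly_Mapping.lookup f' t"
  proof (cases "t \<in> X")
    case True
    then show ?thesis
      using eq[of "conj (inv g) t"] g X_subset conj_inv(1)[of g t] conj_in_X[of "inv g" t] by auto
  next
    case False
    then show ?thesis using f by (simp add: lookup_supported)
  qed
qed

sublocale yd: yetter_drinfeld_module G pm_scale act coact "supported X"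
proof
  note X = subsetD[OF X_subset]
  note act_X = act_in_supported[OF _ order_refl conj_in_X]
  show "pm.subspace (supported X)" by (rule subspace_supported)
  show act_supp: "act g v \<in> supported X" if "g \<in> carrier G" "v \<in> supported X" for g v
    using that by (intro act_X)
  have add: "v + w \<in> supported X" if "v \<in> supported X" "w \<in> supported X" for v w :: "'g \<Rightarrow>\<^sub>0 'k"
    using that by (rule pm.subspace_add[OF subspace_supported])
  have scale: "pm_scale a v \<in> supported X" if "v \<in> supported X" for v :: "'g \<Rightarrow>\<^sub>0 'k" and a
    using that by (rule pm.subspace_scale[OF subspace_supported])
  show "act g (v + w) = act g v + act g w"
    if "g \<in> carrier G" "v \<in> supported X" "w \<in> supported X" for g v w
    using that add by (intro coordinates_eqI[of g]) (auto simp: lookup_add lookup_act X algebra_simps act_supp)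
  show "act g (pm_scale a v) = pm_scale a (act g v)"
    if "g \<in> carrier G" "v \<in> supported X" for g v a
    using that scale by (intro coordinates_eqI[of g]) (auto simp: lookup_act X act_supp)
  show "act \<one> v = v" if "v \<in> supported X" for v
  proof (rule coordinates_eqI[of \<one>])
    fix t assume "t \<in> X"
    then show "Poly_Mapping.lookup (act \<one> v) (conj \<one> t) = Poly_Mapping.lookup v (conj \<one> t)"
      using lookup_act[OF one_closed that X, of t] by (simp add: c_one conj_one X)
  qed (use that act_supp in auto)
  show "act (g \<otimes> h) v = act g (act h v)"
    if "g \<in> carrier G" "h \<in> carrier G" "v \<in> supported X" for g h v
  proof (rule coordinates_eqI[of "g \<otimes> h"])
    fix t assume "t \<in> X"
    then show "Poly_Mapping.lookup (act (g \<otimes> h) v) (conj (g \<otimes> h) t) =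
        Poly_Mapping.lookup (act g (act h v)) (conj (g \<otimes> h) t)"
      using that lookup_act[of "g \<otimes> h" v t] lookup_act[of g "act h v" "conj h t"] lookup_act[of h v t]
        c_mult[of g h t, folded conj_def] X[of t]
      by (simp add: conj_mult conj_closed act_supp)
  qed (use that act_supp in auto)
  show "Poly_Mapping.keys (coact v) \<subseteq> carrier G" if "v \<in> supported X" for v
    using that X by (auto simp: keys_coact supported_def)
  show "Poly_Mapping.lookup (coact v) g \<in> supported X" if "v \<in> supported X" for v g
    using that by (auto intro!: supportedI simp: lookup_single when_def lookup_supported)
  show "coact (v + w) = coact v + coact w" for v w
    by (rule poly_mapping_eqI) (simp add: lookup_add single_add)
  show "Poly_Mapping.lookup (coact (pm_scale a v)) g = pm_scale a (Poly_Mapping.lookup (coact v) g)" for a v g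
    by simp
  show "(\<Sum>g\<in>Poly_Mapping.keys (coact v). Poly_Mapping.lookup (coact v) g) = v" for v
    by (simp add: keys_coact sum_of_coordinates)
  show "coact (Poly_Mapping.lookup (coact v) g) = Poly_Mapping.single g (Poly_Mapping.lookup (coact v) g)" for v g
    by (rule poly_mapping_eqI) (auto simp: lookup_single when_def)
  show "Poly_Mapping.lookup (coact (act g v)) (g \<otimes> h \<otimes> inv g) = act g (Poly_Mapping.lookup (coact v) h)"
    if "g \<in> carrier G" "h \<in> carrier G" "v \<in> supported X" for g h v
  proof -
    have "act g (Poly_Mapping.single h a) = Poly_Mapping.single (conj g h) (c g h * a)" for a
      by (cases "a = 0") (simp_all add: act_def mult.commute)
    then show ?thesis
      using lookup_act[OF that(1,3,2)] by (simp flip: conj_def)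
  qed
qed

lemma c_nonzero: assumes "g \<in> carrier G" "s \<in> X" shows "c g s \<noteq> 0"
  using c_mult[of "inv g" g s] assms c_one[of s] by auto

text \<open>
  A submodule contains the homogeneous components of its elements, and those of degree \<open>s\<close> are
  multiples of one basis vector. So a submodule is a coordinate subspace, for a set of indices that
  is stable under conjugation because the cocycle has no zeros.
\<close>

lemma submodule_iff:
  "yd.submodule U \<longleftrightarrow>
     (\<exists>A\<subseteq>X. (\<forall>g\<in>carrier G. \<forall>s\<in>A. conj g s \<in> A) \<and> U = supported A)"
proof
  assume U: "yd.submodule U"
  define A where "A = {s. Poly_Mapping.single s (1 :: 'k) \<in> U}"
  have sub: "U \<subseteq> supported X" "pm.subspace U"
    using U by (simp_all add: yd.submodule_def)
  have AX: "A \<subseteq> X"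
    using sub(1) single_in_supported by (auto simp: A_def)
  have scaled: "s \<in> A" if "Poly_Mapping.single s a \<in> U" "a \<noteq> 0" for s a
    using pm.subspace_scale[OF sub(2) that(1), of "inverse a"] that(2) by (simp add: A_def)
  have "conj g s \<in> A" if g: "g \<in> carrier G" and s: "s \<in> A" for g s
  proof -
    have "act g (Poly_Mapping.single s 1) \<in> U"
      using U g s by (auto simp: yd.submodule_def A_def)
    then have "Poly_Mapping.single (conj g s) (c g s) \<in> U"
      by (simp add: act_def)
    then show ?thesis
      using scaled c_nonzero[OF g] s AX by blast
  qed
  moreover have "U = supported A"
  proof
    show "supported A \<subseteq> U"
      by (rule subspace_contains_supported[OF sub(2)]) (simp add: A_def)
    show "U \<subseteq> supported A"
    proof
      fix u assume "u \<in> U"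
      then have "Poly_Mapping.single s (Poly_Mapping.lookup u s) \<in> U" for s
        using U by (metis yd.submodule_def lookup_coact)
      then show "u \<in> supported A"
        using scaled by (intro supportedI) blast
    qed
  qed
  ultimately show "\<exists>A\<subseteq>X. (\<forall>g\<in>carrier G. \<forall>s\<in>A. conj g s \<in> A) \<and> U = supported A"
    using AX by blast
next
  assume "\<exists>A\<subseteq>X. (\<forall>g\<in>carrier G. \<forall>s\<in>A. conj g s \<in> A) \<and> U = supported A"
  then obtain A where A: "A \<subseteq> X" "\<And>g s. g \<in> carrier G \<Longrightarrow> s \<in> A \<Longrightarrow> conj g s \<in> A" "U = supported A"
    by blast
  then show "yd.submodule U"
    unfolding yd.submodule_def
    by (auto simp: subspace_supported act_in_supported intro!: supportedI)
       (auto simp: supported_def lookup_single when_def in_keys_iff split: if_splits)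
qed

definition conj_class :: "'g set \<Rightarrow> bool" where
  "conj_class A \<longleftrightarrow> A \<noteq> {} \<and> A \<subseteq> X \<and>
     (\<forall>g\<in>carrier G. \<forall>s\<in>A. conj g s \<in> A) \<and> (\<forall>s\<in>A. \<forall>t\<in>A. \<exists>g\<in>carrier G. conj g s = t)"

lemma conj_class_subset:
  assumes A: "conj_class A" and B: "\<forall>g\<in>carrier G. \<forall>s\<in>B. conj g s \<in> B" and s: "s \<in> A" "s \<in> B"
  shows "A \<subseteq> B"
proof
  fix t assume "t \<in> A"
  then have "\<exists>g\<in>carrier G. conj g s = t" using A s(1) unfolding conj_class_def by simp
  then show "t \<in> B" using B s(2) by auto
qed

lemma conj_class_stable: "conj_class A \<Longrightarrow> \<forall>g\<in>carrier G. \<forall>s\<in>A. conj g s \<in> A"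
  by (simp add: conj_class_def)

lemma conj_class_eq: "conj_class A \<Longrightarrow> conj_class B \<Longrightarrow> s \<in> A \<Longrightarrow> s \<in> B \<Longrightarrow> A = B"
  by (intro subset_antisym conj_class_subset conj_class_stable)

lemma simple_supported_conj_class:
  assumes A: "conj_class A"
  shows "yd.simple_submodule (supported A)"
  unfolding yd.simple_submodule_def
proof (intro conjI allI impI)
  show "yd.submodule (supported A)"
    using A conj_class_stable[OF A] unfolding submodule_iff by (auto simp: conj_class_def)
  show "supported A \<noteq> {0}"
    using A by (simp add: supported_eq_0_iff conj_class_def)
  fix W assume "yd.submodule W \<and> W \<subseteq> supported A"
  then obtain B where B: "B \<subseteq> A" "W = supported B" "\<forall>g\<in>carrier G. \<forall>s\<in>B. conj g s \<in> B"
    by (auto simp: submodule_iff)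
  show "W = {0} \<or> W = supported A"
  proof (cases "B = {}")
    case False
    then obtain s where "s \<in> B" by blast
    then have "A \<subseteq> B" using conj_class_subset[OF A B(3)] B(1) by blast
    then show ?thesis using B by auto
  qed (simp add: B supported_eq_0_iff)
qed

text \<open>
  The homogeneous components are lines, so even the set of summands is determined: a simple summand
  contains the coordinate subspace of a class, hence equals it, and every class occurs because each
  basis vector is a sum of elements of the summands.
\<close>

lemma simple_decomposition_unique:
  assumes classes: "\<And>A. A \<in> \<A> \<Longrightarrow> conj_class A" and X: "\<Union>\<A> = X"
    and D: "yd.simple_decomposition D"
  shows "D = supported ` \<A>"
proof -
  have simple: "\<exists>A\<in>\<A>. U = supported A" if U: "U \<in> D" for U
  proof -
    have U': "yd.simple_submodule U" using D U by (simp add: yd.simple_decomposition_def)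
    then obtain B where B: "B \<subseteq> X" "\<forall>g\<in>carrier G. \<forall>s\<in>B. conj g s \<in> B" "U = supported B"
      by (auto simp: yd.simple_submodule_def submodule_iff)
    have "B \<noteq> {}" using U' B(3) by (auto simp: yd.simple_submodule_def supported_eq_0_iff)
    then obtain s A where s: "s \<in> B" "s \<in> A" and A: "A \<in> \<A>" using B(1) X by blast
    have "A \<subseteq> B" using conj_class_subset[OF classes[OF A] B(2)] s by blast
    then have "supported A \<subseteq> U" using B(3) by simp
    moreover have "yd.simple_submodule (supported A)"
      using simple_supported_conj_class classes A by blast
    ultimately have "supported A = U"
      using U' unfolding yd.simple_submodule_def by blast
    then show ?thesis using A by blast
  qed
  have "supported A \<in> D" if A: "A \<in> \<A>" for A
  proof -
    obtain s where s: "s \<in> A" using classes[OF A] by (auto simp: conj_class_def)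
    then have "Poly_Mapping.single s (1 :: 'k) \<in> supported X" using A X by auto
    then have "Poly_Mapping.single s (1 :: 'k) \<in> (\<lambda>u. \<Sum>U\<in>D. u U) ` (\<Pi>\<^sub>E U\<in>D. U)"
      using D unfolding yd.simple_decomposition_def internal_direct_sum_def bij_betw_def by simp
    then obtain u where u: "u \<in> (\<Pi>\<^sub>E U\<in>D. U)" "Poly_Mapping.single s (1 :: 'k) = (\<Sum>U\<in>D. u U)"
      by blast
    then have "(\<Sum>U\<in>D. Poly_Mapping.lookup (u U) s) \<noteq> 0"
      by (metis lookup_single_eq lookup_sum zero_neq_one)
    then obtain U where U: "U \<in> D" "Poly_Mapping.lookup (u U) s \<noteq> 0"
      by (meson sum.not_neutral_contains_not_neutral)
    then obtain B where B: "B \<in> \<A>" "U = supported B" using simple by blast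
    have "u U \<in> supported B" using u(1) U(1) B(2) by auto
    then have "s \<in> B" using U(2) lookup_supported by metis
    then have "A = B" using conj_class_eq classes A B s by blast
    then show ?thesis using U B by simp
  qed
  then show ?thesis using simple by blast
qed

lemma simple_decomposition_conj_classes:
  assumes fin: "finite \<A>" and classes: "\<And>A. A \<in> \<A> \<Longrightarrow> conj_class A" and X: "\<Union>\<A> = X"
  shows "yd.simple_decomposition (supported ` \<A>)" and "yd.rank = card \<A>"
proof -
  have "internal_direct_sum (supported ` \<A>) (supported (\<Union>\<A>) :: ('g \<Rightarrow>\<^sub>0 'k) set)"
  proof (intro internal_direct_sum_supported fin)
    fix A B assume "A \<in> \<A>" "B \<in> \<A>" "A \<noteq> B"
    then show "A \<inter> B = {}" using conj_class_eq[OF classes classes, of A B] by blast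
  qed
  then show dec: "yd.simple_decomposition (supported ` \<A>)"
    using simple_supported_conj_class classes by (auto simp: yd.simple_decomposition_def X)
  have "card (supported ` \<A> :: ('g \<Rightarrow>\<^sub>0 'k) set set) = card \<A>"
    by (rule card_image[OF inj_supported])
  then show "yd.rank = card \<A>"
    using dec simple_decomposition_unique[OF classes X]
    unfolding yd.rank_def by (intro the_equality exI[of _ "supported ` \<A>"] conjI) (metis | simp)+
qed

end

section \<open>Matrices of rank one\<close>

lemma (in vec_space) in_span_singletonD:
  assumes u: "u \<in> carrier_vec n" and w: "w \<in> span {u}"
  shows "\<exists>a. w = a \<cdot>\<^sub>v u"
proof -
  obtain a where "w = lincomb a {u}"
    using w finite_span[of "{u}"] u by auto
  then have "w = a u \<cdot>\<^sub>v u"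
    using u lincomb_def[of a "{u}"] by (simp add: M.finsum_insert)
  then show ?thesis ..
qed

text \<open>Outer products stay outer products under multiplication from both sides, and the vanishing of
  their minors is immediate: the first is what conjugation of reflections needs, the second is what
  their classification needs.\<close>

lemma (in vec_space) rank_eq_1_iff:
  assumes A: "A \<in> carrier_mat n nc"
  shows "rank A = 1 \<longleftrightarrow> A \<noteq> 0\<^sub>m n nc \<and> (\<exists>f g. \<forall>r<n. \<forall>l<nc. A $$ (r, l) = f r * g l)"
proof -
  have cols: "col A l \<in> carrier_vec n" "col A l \<in> set (cols A)" if "l < nc" for l
    using that A by (auto simp: cols_def)
  have indpt: "lin_indpt {u}" if "u \<in> carrier_vec n" "u \<noteq> 0\<^sub>v n" for u
    using lin_dep_iff_in_span[of "{}" u] that span_empty finite_lin_indpt2[of "{}"] by auto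
  have nonzero_col: "\<exists>l<nc. col A l \<noteq> 0\<^sub>v n" if "A \<noteq> 0\<^sub>m n nc"
  proof (rule ccontr)
    assume "\<not> ?thesis"
    then have zero: "col A l = 0\<^sub>v n" if "l < nc" for l using that by blast
    have "A $$ (r, l) = 0" if "r < n" "l < nc" for r l
      using zero[OF that(2)] that A by (metis carrier_matD index_col index_zero_vec(1))
    then show False using \<open>A \<noteq> 0\<^sub>m n nc\<close> A by (auto intro!: eq_matI)
  qed
  show ?thesis
  proof (intro iffI conjI)
    assume "rank A = 1"
    then show "A \<noteq> 0\<^sub>m n nc" using rank_0I[of nc] by auto
    then obtain l0 where l0: "l0 < nc" "col A l0 \<noteq> 0\<^sub>v n" using nonzero_col by blast
    define u where "u = col A l0"
    have u: "u \<in> carrier_vec n" "lin_indpt {u}" using l0 cols indpt by (auto simp: u_def)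
    have "\<exists>a. col A l = a \<cdot>\<^sub>v u" if l: "l < nc" for l
    proof (cases "col A l = u")
      case True
      then show ?thesis using u by (auto intro: exI[of _ 1])
    next
      case False
      have "lin_dep {u, col A l}"
      proof (rule ccontr)
        assume "\<not> lin_dep {u, col A l}"
        then have "card {u, col A l} \<le> rank A"
          using cols l0 l by (intro rank_ge_card_indpt[OF A]) (auto simp: u_def)
        then show False using \<open>rank A = 1\<close> False by simp
      qed
      then have "col A l \<in> span {u}"
        using lin_dep_iff_in_span[of "{u}" "col A l"] u cols[OF l] False by (simp add: insert_commute)
      then show ?thesis using in_span_singletonD u by blast
    qed
    then obtain g where g: "col A l = g l \<cdot>\<^sub>v u" if "l < nc" for l by metis
    have "A $$ (r, l) = u $ r * g l" if "r < n" "l < nc" for r l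
      using arg_cong[OF g[OF that(2)], of "\<lambda>v. v $ r"] that A u(1) by simp
    then show "\<exists>f g. \<forall>r<n. \<forall>l<nc. A $$ (r, l) = f r * g l"
      by (intro exI[of _ "\<lambda>r. u $ r"] exI[of _ g]) simp
  next
    assume *: "A \<noteq> 0\<^sub>m n nc \<and> (\<exists>f g. \<forall>r<n. \<forall>l<nc. A $$ (r, l) = f r * g l)"
    then obtain l where l: "l < nc" "col A l \<noteq> 0\<^sub>v n" using nonzero_col by blast
    have "card {col A l} \<le> rank A"
      using l cols[of l] indpt by (intro rank_ge_card_indpt[OF A]) auto
    moreover obtain f g where "\<forall>r<n. \<forall>l<nc. A $$ (r, l) = f r * g l" using * by blast
    then have "rank A \<le> 1"
      using A by (intro rank_le_1_product_entries[OF A, of f g]) auto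
    ultimately show "rank A = 1" by simp
  qed
qed

section \<open>Monomial matrices\<close>

definition monomial :: "nat \<Rightarrow> (nat \<Rightarrow> nat) \<Rightarrow> (nat \<Rightarrow> 'k) \<Rightarrow> 'k::field mat" where
  "monomial n \<sigma> c = mat n n (\<lambda>(r, l). if r = \<sigma> l then c l else 0)"

lemma monomial_carrier [simp]: "monomial n \<sigma> c \<in> carrier_mat n n"
  by (simp add: monomial_def)

lemma monomial_dim [simp]: "dim_row (monomial n \<sigma> c) = n" "dim_col (monomial n \<sigma> c) = n"
  by (simp_all add: monomial_def)

lemma monomial_index: "r < n \<Longrightarrow> l < n \<Longrightarrow> monomial n \<sigma> c $$ (r, l) = (if r = \<sigma> l then c l else 0)"
  by (simp add: monomial_def)

lemma monomial_cong:
  "(\<And>l. l < n \<Longrightarrow> \<sigma> l = \<tau> l) \<Longrightarrow> (\<And>l. l < n \<Longrightarrow> c l = d l) \<Longrightarrow> monomial n \<sigma> c = monomial n \<tau> d"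
  by (auto simp: monomial_def)

lemma monomial_one: "monomial n id (\<lambda>_. 1) = 1\<^sub>m n"
  by (auto simp: monomial_def)

lemma monomial_eqD:
  assumes eq: "monomial n \<sigma> c = monomial n \<tau> d" and l: "l < n" "\<sigma> l < n" "c l \<noteq> 0"
  shows "\<sigma> l = \<tau> l" "c l = d l"
  using arg_cong[OF eq, of "\<lambda>M. M $$ (\<sigma> l, l)"] l by (auto simp: monomial_index split: if_splits)

lemma monomial_mult:
  assumes "\<And>l. l < n \<Longrightarrow> \<tau> l < n"
  shows "monomial n \<sigma> c * monomial n \<tau> d = monomial n (\<sigma> \<circ> \<tau>) (\<lambda>l. c (\<tau> l) * d l)"
proof (rule eq_matI)
  fix r l assume "r < dim_row (monomial n (\<sigma> \<circ> \<tau>) (\<lambda>l. c (\<tau> l) * d l))"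
    and "l < dim_col (monomial n (\<sigma> \<circ> \<tau>) (\<lambda>l. c (\<tau> l) * d l))"
  then have rl: "r < n" "l < n" by simp_all
  have "(monomial n \<sigma> c * monomial n \<tau> d) $$ (r, l) =
      (\<Sum>i\<in>{0..<n}. (if r = \<sigma> i then c i else 0) * (if i = \<tau> l then d l else 0))"
    using rl by (simp add: scalar_prod_def monomial_index)
  also have "\<dots> = (\<Sum>i\<in>{0..<n}. if i = \<tau> l then (if r = \<sigma> (\<tau> l) then c (\<tau> l) * d l else 0) else 0)"
    by (intro sum.cong) auto
  also have "\<dots> = (if r = \<sigma> (\<tau> l) then c (\<tau> l) * d l else 0)"
    using assms[OF rl(2)] by (simp add: sum.delta)
  finally show "(monomial n \<sigma> c * monomial n \<tau> d) $$ (r, l) =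
      monomial n (\<sigma> \<circ> \<tau>) (\<lambda>l. c (\<tau> l) * d l) $$ (r, l)"
    using rl by (simp add: monomial_index)
qed simp_all

lemma endo_eq_monomial:
  "endo n (\<lambda>l. c l \<cdot>\<^sub>v unit_vec n (\<sigma> l)) = monomial n \<sigma> c"
  by (auto simp: endo_def monomial_def mat_of_cols_def unit_vec_def)

text \<open>The reflections \<open>s\<^sub>i\<^sup>k\<close> and \<open>\<theta>\<^sup>k(ij)\<close> depend on \<open>k\<close> only through \<open>z = \<theta>\<^sup>k\<close>. With the
  coefficient instead of the exponent, and without the restriction \<open>i < j\<close>, conjugation acts by
  uniform formulas.\<close>

definition dref :: "nat \<Rightarrow> nat \<Rightarrow> 'k \<Rightarrow> 'k::field mat" where
  "dref n i z = monomial n id (\<lambda>l. if l = i then z else 1)"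

definition sref :: "nat \<Rightarrow> nat \<Rightarrow> nat \<Rightarrow> 'k \<Rightarrow> 'k::field mat" where
  "sref n i j z = monomial n (Transposition.transpose i j)
     (\<lambda>l. if l = i then z else if l = j then inverse z else 1)"

lemma diag_refl_eq_dref: "diag_refl n \<theta> i k = dref n i (\<theta> ^ k)"
proof -
  have "(\<lambda>l. if l = i then \<theta> ^ k \<cdot>\<^sub>v unit_vec n i else unit_vec n l) =
      (\<lambda>l. (if l = i then \<theta> ^ k else 1) \<cdot>\<^sub>v unit_vec n (id l))"
    by auto
  then show ?thesis
    unfolding diag_refl_def dref_def by (simp only: endo_eq_monomial)
qed

lemma swap_refl_eq_sref: "i \<noteq> j \<Longrightarrow> swap_refl n \<theta> i j k = sref n i j (\<theta> ^ k)"
proof -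
  assume "i \<noteq> j"
  then have "(\<lambda>l. if l = i then \<theta> ^ k \<cdot>\<^sub>v unit_vec n j
                 else if l = j then inverse (\<theta> ^ k) \<cdot>\<^sub>v unit_vec n i
                 else unit_vec n l) =
      (\<lambda>l. (if l = i then \<theta> ^ k else if l = j then inverse (\<theta> ^ k) else 1) \<cdot>\<^sub>v
         unit_vec n (Transposition.transpose i j l))"
    by (auto simp: Transposition.transpose_def)
  then show ?thesis
    unfolding swap_refl_def sref_def by (simp only: endo_eq_monomial)
qed

lemma sref_commute: "i \<noteq> j \<Longrightarrow> sref n j i z = sref n i j (inverse z)"
  unfolding sref_def by (intro monomial_cong) (auto simp: Transposition.transpose_def)

lemma monomial_mult_dref:
  assumes "\<sigma> permutes {..<n}" "i < n"
  shows "monomial n \<sigma> c * dref n i z = dref n (\<sigma> i) z * monomial n \<sigma> c"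
proof -
  have lt: "\<sigma> l < n" if "l < n" for l using permutes_in_image[OF assms(1), of l] that by simp
  have "\<sigma> l = \<sigma> i \<longleftrightarrow> l = i" for l using permutes_inj[OF assms(1)] by (auto dest: injD)
  then show ?thesis
    unfolding dref_def by (subst (1 2) monomial_mult) (auto simp: lt intro!: monomial_cong)
qed

lemma monomial_mult_sref:
  assumes "\<sigma> permutes {..<n}" "i < n" "j < n" "i \<noteq> j" "c i \<noteq> 0" "c j \<noteq> 0" "z \<noteq> 0"
  shows "monomial n \<sigma> c * sref n i j z = sref n (\<sigma> i) (\<sigma> j) (z * c j / c i) * monomial n \<sigma> c"
proof -
  have lt: "\<sigma> l < n" if "l < n" for l using permutes_in_image[OF assms(1), of l] that by simp
  have lt': "Transposition.transpose i j l < n" if "l < n" for l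
    using that assms by (auto simp: Transposition.transpose_def)
  have inj: "\<sigma> k = \<sigma> l \<longleftrightarrow> k = l" for k l using permutes_inj[OF assms(1)] by (auto dest: injD)
  show ?thesis
    unfolding sref_def using assms(2-)
    by (subst (1 2) monomial_mult)
       (auto simp: lt lt' inj Transposition.transpose_def field_simps intro!: monomial_cong)
qed

text \<open>An element \<open>1 - s\<close> of rank one is an outer product \<open>u \<alpha>\<^sup>T\<close>; its covector \<open>\<alpha>\<close>, unique up to a
  scalar, spans the root line of \<open>s\<close>.\<close>

definition root_of :: "nat \<Rightarrow> 'k::field mat \<Rightarrow> 'k vec \<Rightarrow> bool" where
  "root_of n s \<alpha> \<longleftrightarrow> \<alpha> \<in> carrier_vec n \<and>
     (\<exists>u. \<forall>r<n. \<forall>l<n. (1\<^sub>m n - s) $$ (r, l) = u r * \<alpha> $ l)"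

lemma root_of_dref:
  assumes "i < n"
  shows "root_of n (dref n i z) (unit_vec n i)"
  unfolding root_of_def
  using assms by (intro conjI exI[of _ "\<lambda>r. if r = i then 1 - z else 0"])
     (auto simp: dref_def monomial_index unit_vec_def)

lemma root_of_sref:
  assumes "i < n" "j < n" "i \<noteq> j" "z \<noteq> 0"
  shows "root_of n (sref n i j z) (unit_vec n i - inverse z \<cdot>\<^sub>v unit_vec n j)"
  unfolding root_of_def
  using assms by (intro conjI exI[of _ "\<lambda>r. if r = i then 1 else if r = j then - z else 0"])
     (auto simp: sref_def monomial_index unit_vec_def Transposition.transpose_def)

lemma root_of_conjugate:
  assumes s: "s \<in> carrier_mat n n" and g: "g \<in> carrier_mat n n" "h \<in> carrier_mat n n" "g * h = 1\<^sub>m n"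
    and root: "root_of n s \<alpha>"
  shows "root_of n (g * s * h) (transpose_mat h *\<^sub>v \<alpha>)"
proof -
  obtain u where \<alpha>: "\<alpha> \<in> carrier_vec n"
    and u: "\<And>r l. r < n \<Longrightarrow> l < n \<Longrightarrow> (1\<^sub>m n - s) $$ (r, l) = u r * \<alpha> $ l"
    using root by (auto simp: root_of_def)
  define U where "U = mat n 1 (\<lambda>(r, _). u r)"
  define R where "R = mat 1 n (\<lambda>(_, l). \<alpha> $ l)"
  have UR: "U \<in> carrier_mat n 1" "R \<in> carrier_mat 1 n" by (simp_all add: U_def R_def)
  have "1\<^sub>m n - s = U * R"
    using s u by (intro eq_matI) (auto simp: U_def R_def scalar_prod_def)
  then have "g * (U * R) * h = g * (1\<^sub>m n - s) * h" by simp
  also have "\<dots> = (g - g * s) * h"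
    using s g by (simp add: mult_minus_distrib_mat[where n = n and nc = n])
  also have "\<dots> = 1\<^sub>m n - g * s * h"
    using s g by (simp add: minus_mult_distrib_mat[where nr = n and n = n and nc = n])
  finally have "1\<^sub>m n - g * s * h = g * (U * R) * h" by simp
  also have "\<dots> = (g * U) * (R * h)"
    using UR g by (simp add: assoc_mult_mat[of _ n n _ 1 _ n] assoc_mult_mat[of _ n 1 _ n _ n]
        assoc_mult_mat[of _ n n _ n _ n])
  finally have eq: "1\<^sub>m n - g * s * h = (g * U) * (R * h)" .
  have "(1\<^sub>m n - g * s * h) $$ (r, l) = (g * U) $$ (r, 0) * (transpose_mat h *\<^sub>v \<alpha>) $ l"
    if "r < n" "l < n" for r l
  proof -
    have "(R * h) $$ (0, l) = (transpose_mat h *\<^sub>v \<alpha>) $ l"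
      using that g \<alpha> by (simp add: R_def scalar_prod_def mult.commute)
    then show ?thesis
      using that UR g by (simp only: eq) (simp add: scalar_prod_def)
  qed
  then show ?thesis
    using g \<alpha> unfolding root_of_def by (intro conjI exI[of _ "\<lambda>r. (g * U) $$ (r, 0)"]) auto
qed

lemma root_of_unique:
  assumes "root_of n s \<alpha>" "root_of n s \<beta>" and s: "s \<in> carrier_mat n n" "s \<noteq> 1\<^sub>m n"
  shows "\<exists>a. \<alpha> = a \<cdot>\<^sub>v \<beta>"
proof -
  obtain u v where \<alpha>: "\<alpha> \<in> carrier_vec n" "\<And>r l. r < n \<Longrightarrow> l < n \<Longrightarrow> (1\<^sub>m n - s) $$ (r, l) = u r * \<alpha> $ l"
    and \<beta>: "\<beta> \<in> carrier_vec n" "\<And>r l. r < n \<Longrightarrow> l < n \<Longrightarrow> (1\<^sub>m n - s) $$ (r, l) = v r * \<beta> $ l"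
    using assms(1,2) unfolding root_of_def by blast
  have "\<exists>r<n. \<exists>l<n. (1\<^sub>m n - s) $$ (r, l) \<noteq> 0"
  proof (rule ccontr)
    assume "\<not> ?thesis"
    then have "s $$ (r, l) = 1\<^sub>m n $$ (r, l)" if "r < n" "l < n" for r l
      using that s(1) by force
    then show False using s by (auto intro!: eq_matI)
  qed
  then obtain r l where rl: "r < n" "l < n" "(1\<^sub>m n - s) $$ (r, l) \<noteq> 0" by blast
  then have "u r \<noteq> 0" using \<alpha>(2)[OF rl(1,2)] by auto
  have "\<alpha> = (v r / u r) \<cdot>\<^sub>v \<beta>"
  proof (rule eq_vecI)
    fix k assume "k < dim_vec ((v r / u r) \<cdot>\<^sub>v \<beta>)"
    then have "k < n" using \<beta> by simp
    then have "u r * \<alpha> $ k = v r * \<beta> $ k" using \<alpha>(2)[of r k] \<beta>(2)[of r k] rl(1) by simp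
    then show "\<alpha> $ k = ((v r / u r) \<cdot>\<^sub>v \<beta>) $ k"
      using \<open>u r \<noteq> 0\<close> \<open>k < n\<close> \<beta>(1) by (simp add: field_simps)
  qed (use \<alpha> \<beta> in simp)
  then show ?thesis ..
qed

section \<open>The group $G(m,p,n)$ and its reflections\<close>

locale imprimitive_reflection_group =
  fixes m p n :: nat and \<theta> :: "'k::field"
  assumes n_ge_2: "2 \<le> n" and m_pos: "0 < m" and p_dvd_m: "p dvd m"
    and primitive: "primitive_root_of_unity m \<theta>"
begin

abbreviation "G \<equiv> reflection_group m p n \<theta>"
abbreviation "S \<equiv> reflections m p n \<theta>"

definition \<mu> :: "'k set" where "\<mu> = range (\<lambda>k::nat. \<theta> ^ k)"

lemma p_pos: "0 < p"
  using p_dvd_m m_pos by (auto intro: Nat.gr0I)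

lemma theta_m: "\<theta> ^ m = 1"
  using primitive by (simp add: primitive_root_of_unity_def)

lemma theta_nonzero [simp]: "\<theta> \<noteq> 0"
  using theta_m m_pos by (auto simp: power_0_left)

lemma theta_pow_mod: "\<theta> ^ k = \<theta> ^ (k mod m)"
proof -
  have "\<theta> ^ k = \<theta> ^ (m * (k div m) + k mod m)" by simp
  also have "\<dots> = \<theta> ^ (k mod m)" by (simp only: power_add power_mult theta_m) simp
  finally show ?thesis .
qed

lemma theta_pow_eq_1_iff: "\<theta> ^ k = 1 \<longleftrightarrow> m dvd k"
proof
  assume "\<theta> ^ k = 1"
  then have "\<theta> ^ (k mod m) = 1" using theta_pow_mod by metis
  then have "k mod m = 0"
    using primitive m_pos unfolding primitive_root_of_unity_def by (metis mod_less_divisor neq0_conv)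
  then show "m dvd k" by (simp add: dvd_eq_mod_eq_0)
qed (auto simp: power_mult theta_m elim: dvdE)

lemma theta_pow_inj: "inj_on (\<lambda>k. \<theta> ^ k) {..<m}"
proof -
  have "j = k" if "j \<le> k" "k < m" "\<theta> ^ j = \<theta> ^ k" for j k
  proof -
    have "\<theta> ^ j * \<theta> ^ (k - j) = \<theta> ^ j * 1"
      using that by (metis le_add_diff_inverse mult.right_neutral power_add)
    then have "m dvd k - j" by (simp add: theta_pow_eq_1_iff)
    then show "j = k" using that by (auto dest: dvd_imp_le)
  qed
  then show ?thesis by (intro inj_onI) (metis lessThan_iff nle_le)
qed

lemma theta_pow_eqD: "\<theta> ^ j = \<theta> ^ k \<Longrightarrow> j < m \<Longrightarrow> k < m \<Longrightarrow> j = k"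
  using theta_pow_inj by (auto dest: inj_onD)

lemma theta_pow_quotient_iff: "(\<theta> ^ k) ^ (m div p) = 1 \<longleftrightarrow> p dvd k"
proof -
  obtain q where q: "m = p * q" using p_dvd_m by blast
  then have "q > 0" using m_pos by simp
  have "(\<theta> ^ k) ^ (m div p) = 1 \<longleftrightarrow> p * q dvd k * q"
    using q p_pos by (simp add: theta_pow_eq_1_iff flip: power_mult)
  then show ?thesis using \<open>q > 0\<close> by simp
qed

lemma mu_theta [simp]: "\<theta> ^ k \<in> \<mu>"
  by (simp add: \<mu>_def)

lemma mu_one [simp]: "1 \<in> \<mu>"
  using mu_theta[of 0] by simp

lemma mu_mult [simp]: "z \<in> \<mu> \<Longrightarrow> w \<in> \<mu> \<Longrightarrow> z * w \<in> \<mu>"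
  by (auto simp: \<mu>_def simp flip: power_add)

lemma mu_nonzero: "z \<in> \<mu> \<Longrightarrow> z \<noteq> 0"
  by (auto simp: \<mu>_def)

lemma mu_pow_m: "z \<in> \<mu> \<Longrightarrow> z ^ m = 1"
  by (auto simp: \<mu>_def power_mult[symmetric] mult.commute[of _ m]) (simp add: power_mult theta_m)

lemma mu_inverse [simp]: "z \<in> \<mu> \<Longrightarrow> inverse z \<in> \<mu>"
proof -
  assume z: "z \<in> \<mu>"
  have "z * z ^ (m - 1) = 1" using mu_pow_m[OF z] m_pos by (metis Suc_diff_1 power_Suc)
  then have "inverse z = z ^ (m - 1)" by (rule inverse_unique)
  then show ?thesis using z by (auto simp: \<mu>_def simp flip: power_mult)
qed

lemma mu_divide [simp]: "z \<in> \<mu> \<Longrightarrow> w \<in> \<mu> \<Longrightarrow> z / w \<in> \<mu>"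
  by (simp add: divide_inverse)

lemma mu_exponent: "z \<in> \<mu> \<Longrightarrow> \<exists>k<m. z = \<theta> ^ k"
proof -
  assume "z \<in> \<mu>"
  then obtain k where "z = \<theta> ^ k" by (auto simp: \<mu>_def)
  then have "z = \<theta> ^ (k mod m)" using theta_pow_mod by simp
  then show ?thesis using m_pos mod_less_divisor by blast
qed

text \<open>The congruence modulo \<open>p\<close> on the sum of the exponents, as an equation between the coefficients
  \<open>c\<^sub>i = \<theta>\<^bsup>\<nu>i\<^esup>\<close>: in this form it is visibly stable under products and inverses.\<close>

definition admissible :: "(nat \<Rightarrow> 'k) \<Rightarrow> bool" where
  "admissible c \<longleftrightarrow> (\<forall>i<n. c i \<in> \<mu>) \<and> (\<Prod>i<n. c i) ^ (m div p) = 1"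

lemma carrier_iff:
  "g \<in> carrier G \<longleftrightarrow> (\<exists>\<sigma> c. g = monomial n \<sigma> c \<and> \<sigma> permutes {..<n} \<and> admissible c)"
proof
  assume "g \<in> carrier G"
  then obtain \<sigma> \<nu> where g: "g = endo n (\<lambda>i. \<theta> ^ \<nu> i \<cdot>\<^sub>v unit_vec n (\<sigma> i))" "\<sigma> permutes {..<n}"
    "p dvd (\<Sum>i<n. \<nu> i)"
    by (auto simp: reflection_group_def)
  have "(\<Prod>i<n. \<theta> ^ \<nu> i) ^ (m div p) = 1"
    using g(3) by (simp add: power_sum[symmetric] theta_pow_quotient_iff)
  then show "\<exists>\<sigma> c. g = monomial n \<sigma> c \<and> \<sigma> permutes {..<n} \<and> admissible c"
    using g by (intro exI[of _ \<sigma>] exI[of _ "\<lambda>i. \<theta> ^ \<nu> i"]) (simp add: endo_eq_monomial admissible_def)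
next
  assume "\<exists>\<sigma> c. g = monomial n \<sigma> c \<and> \<sigma> permutes {..<n} \<and> admissible c"
  then obtain \<sigma> c where g: "g = monomial n \<sigma> c" "\<sigma> permutes {..<n}" and c: "admissible c" by blast
  have "\<forall>i<n. \<exists>k<m. c i = \<theta> ^ k" using c mu_exponent by (auto simp: admissible_def)
  then obtain \<nu> where \<nu>: "\<And>i. i < n \<Longrightarrow> \<nu> i < m" "\<And>i. i < n \<Longrightarrow> c i = \<theta> ^ \<nu> i" by metis
  have "(\<Prod>i<n. \<theta> ^ \<nu> i) ^ (m div p) = 1"
    using c \<nu>(2) by (simp add: admissible_def)
  then have "p dvd (\<Sum>i<n. \<nu> i)"
    by (simp add: power_sum[symmetric] theta_pow_quotient_iff)
  moreover have "g = endo n (\<lambda>i. \<theta> ^ \<nu> i \<cdot>\<^sub>v unit_vec n (\<sigma> i))"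
    unfolding endo_eq_monomial g(1) using \<nu>(2) by (intro monomial_cong) auto
  ultimately show "g \<in> carrier G"
    using g(2) \<nu>(1) unfolding reflection_group_def by auto
qed

lemma carrierE:
  assumes "g \<in> carrier G"
  obtains \<sigma> c where "g = monomial n \<sigma> c" "\<sigma> permutes {..<n}" "admissible c"
  using assms[unfolded carrier_iff] by blast

lemma carrier_monomial: "\<sigma> permutes {..<n} \<Longrightarrow> admissible c \<Longrightarrow> monomial n \<sigma> c \<in> carrier G"
  using carrier_iff by blast

lemma carrier_subset: "g \<in> carrier G \<Longrightarrow> g \<in> carrier_mat n n"
  by (auto simp: carrier_iff)

lemma G_simps [simp]: "monoid.mult G = (*)" "one G = 1\<^sub>m n"
  by (simp_all add: reflection_group_def)

lemma admissible_one: "admissible (\<lambda>_. 1)"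
  by (simp add: admissible_def)

lemma permutes_lt: "\<sigma> permutes {..<n} \<Longrightarrow> l < n \<Longrightarrow> \<sigma> l < n"
  using permutes_in_image[of \<sigma> "{..<n}" l] by simp

sublocale group G
proof (rule groupI)
  show "\<one>\<^bsub>G\<^esub> \<in> carrier G"
    using carrier_monomial[OF permutes_id admissible_one] by (simp add: monomial_one)
next
  fix x y assume "x \<in> carrier G" "y \<in> carrier G"
  then obtain \<sigma> c \<tau> d where x: "x = monomial n \<sigma> c" "\<sigma> permutes {..<n}" "admissible c"
    and y: "y = monomial n \<tau> d" "\<tau> permutes {..<n}" "admissible d"
    by (auto simp: carrier_iff)
  have "(\<Prod>l<n. c (\<tau> l)) = (\<Prod>l<n. c l)"
    using prod.permute[OF y(2), of c] by (simp add: comp_def)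
  then have "admissible (\<lambda>l. c (\<tau> l) * d l)"
    using x(3) y(3) permutes_lt[OF y(2)] by (auto simp: admissible_def prod.distrib power_mult_distrib)
  then show "x \<otimes>\<^bsub>G\<^esub> y \<in> carrier G"
    using carrier_monomial[OF permutes_compose[OF y(2) x(2)]] permutes_lt[OF y(2)]
    by (simp add: x(1) y(1) monomial_mult)
next
  fix x assume "x \<in> carrier G"
  then obtain \<sigma> c where x: "x = monomial n \<sigma> c" "\<sigma> permutes {..<n}" "admissible c"
    by (auto simp: carrier_iff)
  let ?d = "\<lambda>l. inverse (c (inv_into UNIV \<sigma> l))"
  note inv = permutes_inv[OF x(2)]
  have "(\<Prod>l<n. c (inv_into UNIV \<sigma> l)) = (\<Prod>l<n. c l)"
    using prod.permute[OF inv, of c] by (simp add: comp_def)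
  then have "(\<Prod>l<n. ?d l) = inverse (\<Prod>l<n. c l)"
    using prod_inversef[of "\<lambda>l. c (inv_into UNIV \<sigma> l)" "{..<n}"] by (simp add: comp_def)
  then have "admissible ?d"
    using x(3) permutes_lt[OF inv]
    by (auto simp: admissible_def power_inverse)
  then have "monomial n (inv_into UNIV \<sigma>) ?d \<in> carrier G"
    by (rule carrier_monomial[OF inv])
  moreover have "monomial n (inv_into UNIV \<sigma>) ?d * x = monomial n id (\<lambda>_. 1)"
    using x(3) permutes_lt[OF x(2)] permutes_inverses(2)[OF x(2)] mu_nonzero
    by (auto simp: x(1) monomial_mult admissible_def intro!: monomial_cong)
  ultimately show "\<exists>y\<in>carrier G. y \<otimes>\<^bsub>G\<^esub> x = \<one>\<^bsub>G\<^esub>"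
    by (auto simp: monomial_one)
qed (auto dest!: carrier_subset)

lemma inv_carrier_mat: "g \<in> carrier G \<Longrightarrow> inv\<^bsub>G\<^esub> g \<in> carrier_mat n n"
  using carrier_subset by auto

lemma mult_inv: "g \<in> carrier G \<Longrightarrow> g * inv\<^bsub>G\<^esub> g = 1\<^sub>m n" "g \<in> carrier G \<Longrightarrow> inv\<^bsub>G\<^esub> g * g = 1\<^sub>m n"
  using r_inv[of g] l_inv[of g] by simp_all

lemma conjugate_eqI:
  assumes "g \<in> carrier G" "t \<in> carrier G" "g * s = t * g"
  shows "g * s * inv\<^bsub>G\<^esub> g = t"
proof -
  have "t \<otimes>\<^bsub>G\<^esub> g \<otimes>\<^bsub>G\<^esub> inv\<^bsub>G\<^esub> g = t"
    using assms(1,2) m_assoc[of t g "inv\<^bsub>G\<^esub> g"] r_inv[of g] by (simp del: G_simps)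
  then show ?thesis using assms(3) by simp
qed

lemma prod_two_point:
  fixes a b :: 'k
  assumes "i < n" "j < n" "i \<noteq> j"
  shows "(\<Prod>l<n. if l = i then a else if l = j then b else 1) = a * b"
proof -
  have "(\<Prod>l<n. if l = i then a else if l = j then b else 1) =
      (\<Prod>l<n. (if l = i then a else 1) * (if l = j then b else 1))"
    using assms by (intro prod.cong) auto
  then show ?thesis using assms by (simp add: prod.distrib)
qed

lemma dref_carrier: "i < n \<Longrightarrow> z \<in> \<mu> \<Longrightarrow> z ^ (m div p) = 1 \<Longrightarrow> dref n i z \<in> carrier G"
  unfolding dref_def by (rule carrier_monomial[OF permutes_id]) (simp add: admissible_def)

lemma sref_carrier: "i < n \<Longrightarrow> j < n \<Longrightarrow> i \<noteq> j \<Longrightarrow> z \<in> \<mu> \<Longrightarrow> sref n i j z \<in> carrier G"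
  unfolding sref_def
  by (rule carrier_monomial[OF permutes_swap_id]) (auto simp: admissible_def prod_two_point mu_nonzero)

definition diag_reflections :: "'k mat set" where
  "diag_reflections = {dref n i z | i z. i < n \<and> z \<in> \<mu> \<and> z \<noteq> 1 \<and> z ^ (m div p) = 1}"

definition swap_reflections :: "'k mat set" where
  "swap_reflections = {sref n i j z | i j z. i < n \<and> j < n \<and> i \<noteq> j \<and> z \<in> \<mu>}"

lemma dref_ne_one: "i < n \<Longrightarrow> z \<noteq> 1 \<Longrightarrow> dref n i z \<noteq> 1\<^sub>m n"
  using monomial_eqD(2)[of n id "\<lambda>_. 1" id "\<lambda>l. if l = i then z else 1" i]
  by (auto simp: dref_def monomial_one)

lemma sref_ne_one: "i < n \<Longrightarrow> j < n \<Longrightarrow> i \<noteq> j \<Longrightarrow> sref n i j z \<noteq> 1\<^sub>m n"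
  using monomial_eqD(1)[of n id "\<lambda>_. 1" "Transposition.transpose i j"
      "\<lambda>l. if l = i then z else if l = j then inverse z else 1" i]
  by (auto simp: sref_def monomial_one)

lemma reflection_iff_root:
  assumes "s \<in> carrier G"
  shows "s \<in> S \<longleftrightarrow> s \<noteq> 1\<^sub>m n \<and> (\<exists>\<alpha>. root_of n s \<alpha>)"
proof -
  have s: "s \<in> carrier_mat n n" using assms carrier_subset by blast
  have "1\<^sub>m n - s = 0\<^sub>m n n \<longleftrightarrow> s = 1\<^sub>m n"
  proof
    assume eq: "1\<^sub>m n - s = 0\<^sub>m n n"
    have "s $$ (r, l) = 1\<^sub>m n $$ (r, l)" if "r < n" "l < n" for r l
      using arg_cong[OF eq, of "\<lambda>M. M $$ (r, l)"] that s by auto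
    then show "s = 1\<^sub>m n" using s by (auto intro!: eq_matI)
  qed auto
  moreover have "(\<exists>f g. \<forall>r<n. \<forall>l<n. (1\<^sub>m n - s) $$ (r, l) = f r * g l) \<longleftrightarrow> (\<exists>\<alpha>. root_of n s \<alpha>)"
  proof
    assume "\<exists>f g. \<forall>r<n. \<forall>l<n. (1\<^sub>m n - s) $$ (r, l) = f r * g l"
    then obtain f g where "\<forall>r<n. \<forall>l<n. (1\<^sub>m n - s) $$ (r, l) = f r * g l" by blast
    then have "root_of n s (vec n g)" unfolding root_of_def by (intro conjI exI[of _ f]) auto
    then show "\<exists>\<alpha>. root_of n s \<alpha>" ..
  next
    assume "\<exists>\<alpha>. root_of n s \<alpha>"
    then obtain u \<alpha> where "\<forall>r<n. \<forall>l<n. (1\<^sub>m n - s) $$ (r, l) = u r * \<alpha> $ l"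
      unfolding root_of_def by blast
    then show "\<exists>f g. \<forall>r<n. \<forall>l<n. (1\<^sub>m n - s) $$ (r, l) = f r * g l" by (intro exI[of _ u] exI[of _ "\<lambda>l. \<alpha> $ l"])
  qed
  ultimately show ?thesis
    using vec_space.rank_eq_1_iff[OF minus_carrier_mat[OF s], of "1\<^sub>m n"] assms
    by (simp only: reflections_def) simp
qed

text \<open>All \<open>2 \<times> 2\<close> minors of \<open>1 - s\<close> vanish. If the permutation \<open>\<sigma>\<close> of \<open>s\<close> moves \<open>i\<close>, then the
  entry \<open>1\<close> at \<open>(i, i)\<close> forces each entry to be determined by the \<open>i\<close>-th row and column, so that
  \<open>\<sigma>\<close> is a transposition and all but two coefficients are \<open>1\<close>.\<close>

lemma reflections_eq: "S = diag_reflections \<union> swap_reflections"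
proof
  show "diag_reflections \<union> swap_reflections \<subseteq> S"
  proof
    fix s assume "s \<in> diag_reflections \<union> swap_reflections"
    then consider i z where "s = dref n i z" "i < n" "z \<in> \<mu>" "z \<noteq> 1" "z ^ (m div p) = 1"
      | i j z where "s = sref n i j z" "i < n" "j < n" "i \<noteq> j" "z \<in> \<mu>"
      unfolding diag_reflections_def swap_reflections_def by blast
    then show "s \<in> S"
    proof cases
      case 1
      then show ?thesis
        using reflection_iff_root[OF dref_carrier[of i z]] dref_ne_one root_of_dref[of i n z] by auto
    next
      case 2
      then show ?thesis
        using reflection_iff_root[OF sref_carrier[of i j z]] sref_ne_one root_of_sref[of i n j z]
          mu_nonzero by auto
    qed
  qed
  show "S \<subseteq> diag_reflections \<union> swap_reflections"
  proof
    fix s assume s: "s \<in> S"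
    then have "s \<in> carrier G" by (simp add: reflections_def)
    then obtain \<sigma> c where s_eq: "s = monomial n \<sigma> c" and \<sigma>: "\<sigma> permutes {..<n}" and c: "admissible c"
      by (auto simp: carrier_iff)
    have c_mu: "c l \<in> \<mu>" if "l < n" for l using c that by (simp add: admissible_def)
    define A where "A r l = (if r = l then 1 else 0) - (if r = \<sigma> l then c l else 0)" for r l
    have A: "(1\<^sub>m n - s) $$ (r, l) = A r l" if "r < n" "l < n" for r l
      using that by (simp add: s_eq monomial_index A_def)
    obtain u \<alpha> where u: "\<And>r l. r < n \<Longrightarrow> l < n \<Longrightarrow> (1\<^sub>m n - s) $$ (r, l) = u r * \<alpha> $ l"
      using s reflection_iff_root[OF \<open>s \<in> carrier G\<close>] unfolding root_of_def by metis
    have minor: "A r l * A r' l' = A r l' * A r' l" if "r < n" "l < n" "r' < n" "l' < n" for r l r' l'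
      using that by (simp flip: A add: u)
    show "s \<in> diag_reflections \<union> swap_reflections"
    proof (cases "\<forall>l<n. \<sigma> l = l")
      case True
      have "\<exists>i<n. c i \<noteq> 1"
      proof (rule ccontr)
        assume "\<not> ?thesis"
        then have "s = monomial n id (\<lambda>_. 1)" unfolding s_eq using True by (intro monomial_cong) auto
        then show False using s reflection_iff_root[OF \<open>s \<in> carrier G\<close>] by (simp add: monomial_one)
      qed
      then obtain i where i: "i < n" "c i \<noteq> 1" by blast
      have other: "c l = 1" if "l < n" "l \<noteq> i" for l
        using minor[of i i l l] i that True by (simp add: A_def)
      then have "s = dref n i (c i)"
        unfolding s_eq dref_def using True by (intro monomial_cong) auto
      moreover have "(\<Prod>l<n. c l) = (\<Prod>l<n. if l = i then c i else 1)"
        using other by (intro prod.cong) auto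
      then have "c i ^ (m div p) = 1" using c i(1) by (simp add: admissible_def)
      then have "dref n i (c i) \<in> diag_reflections"
        unfolding diag_reflections_def mem_Collect_eq
        by (intro exI[of _ i] exI[of _ "c i"]) (use i c_mu[of i] in auto)
      ultimately show ?thesis by simp
    next
      case False
      then obtain i where i: "i < n" "\<sigma> i \<noteq> i" by blast
      define j where "j = \<sigma> i"
      have j: "j < n" "j \<noteq> i" "\<sigma> i = j" using i permutes_lt[OF \<sigma>] by (auto simp: j_def)
      have "\<sigma> j \<noteq> j" using j permutes_inj[OF \<sigma>] by (auto dest: injD)
      have entry: "A r l = A i l * A r i" if "r < n" "l < n" for r l
        using minor[of i i r l] i that by (simp add: A_def)
      have "A j j = 1" using \<open>\<sigma> j \<noteq> j\<close> by (simp add: A_def)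
      then have *: "A i j * A j i = 1" using entry[of j j] j by simp
      then have \<sigma>j: "\<sigma> j = i" using j by (auto simp: A_def split: if_splits)
      then have cj: "c j = inverse (c i)"
        using * j by (auto simp: A_def intro: inverse_unique[symmetric] simp: mult.commute)
      have "\<sigma> l = l \<and> c l = 1" if "l < n" "l \<noteq> i" "l \<noteq> j" for l
        using entry[of l l] that j by (auto simp: A_def split: if_splits)
      then have "s = sref n i j (c i)"
        unfolding s_eq sref_def using j \<sigma>j cj
        by (intro monomial_cong) (auto simp: Transposition.transpose_def)
      moreover have "sref n i j (c i) \<in> swap_reflections"
        unfolding swap_reflections_def mem_Collect_eq
        by (intro exI[of _ i] exI[of _ j] exI[of _ "c i"]) (use i j c_mu[of i] in auto)
      ultimately show ?thesis by simp
    qed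
  qed
qed

lemma S_subset: "S \<subseteq> carrier G"
  by (auto simp: reflections_def)

lemma S_conjugate:
  assumes "g \<in> carrier G" "s \<in> S"
  shows "g * s * inv\<^bsub>G\<^esub> g \<in> S"
proof -
  have s: "s \<in> carrier G" using assms S_subset by blast
  have c: "g \<otimes>\<^bsub>G\<^esub> s \<otimes>\<^bsub>G\<^esub> inv\<^bsub>G\<^esub> g \<in> carrier G" using assms(1) s by blast
  have "s = \<one>\<^bsub>G\<^esub>" if "\<one>\<^bsub>G\<^esub> = g \<otimes>\<^bsub>G\<^esub> s \<otimes>\<^bsub>G\<^esub> inv\<^bsub>G\<^esub> g"
  proof -
    have "g \<otimes>\<^bsub>G\<^esub> s = \<one>\<^bsub>G\<^esub> \<otimes>\<^bsub>G\<^esub> g"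
      using inv_solve_right[of "\<one>\<^bsub>G\<^esub>" "g \<otimes>\<^bsub>G\<^esub> s" g] that assms(1) s by blast
    then show ?thesis
      using assms(1) s l_one[of g] l_cancel_one[of g s] by (simp del: G_simps)
  qed
  moreover obtain \<alpha> where "root_of n s \<alpha>" using assms(2) reflection_iff_root[OF s] by auto
  then have "root_of n (g * s * inv\<^bsub>G\<^esub> g) (transpose_mat (inv\<^bsub>G\<^esub> g) *\<^sub>v \<alpha>)"
    by (rule root_of_conjugate[OF carrier_subset[OF s] carrier_subset[OF assms(1)]
          inv_carrier_mat[OF assms(1)] mult_inv(1)[OF assms(1)]])
  ultimately show ?thesis
    using assms(2) c reflection_iff_root[OF s] reflection_iff_root[of "g * s * inv\<^bsub>G\<^esub> g"] by auto
qed

lemma dref_eqD: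
  assumes "dref n i z = dref n j w" "i < n" "z \<noteq> 1" "z \<noteq> 0"
  shows "i = j" "z = w"
  using monomial_eqD(2)[OF assms(1)[unfolded dref_def], of i] assms by (auto split: if_splits)

lemma sref_eqD:
  assumes "sref n i j z = sref n i' j' w" "i < j" "j < n" "i' < j'" "z \<noteq> 0"
  shows "i = i'" "j = j'" "z = w"
proof -
  have 1: "Transposition.transpose i j i = Transposition.transpose i' j' i"
    "z = (if i = i' then w else if i = j' then inverse w else 1)"
    using monomial_eqD[OF assms(1)[unfolded sref_def], of i] assms by auto
  have 2: "Transposition.transpose i j j = Transposition.transpose i' j' j"
    using monomial_eqD(1)[OF assms(1)[unfolded sref_def], of j] assms by auto
  show "i = i'" "j = j'" "z = w"
    using 1 2 assms by (auto simp: Transposition.transpose_def split: if_splits)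
qed

lemma dref_ne_sref: "i' \<noteq> j' \<Longrightarrow> i' < n \<Longrightarrow> j' < n \<Longrightarrow> w \<noteq> 0 \<Longrightarrow> dref n i z \<noteq> sref n i' j' w"
  using monomial_eqD(1)[of n "Transposition.transpose i' j'"
      "\<lambda>l. if l = i' then w else if l = j' then inverse w else 1" id "\<lambda>l. if l = i then z else 1" i']
  by (auto simp: dref_def sref_def)

lemma diag_reflections_exponents:
  "diag_reflections = (\<lambda>(i, k). dref n i (\<theta> ^ k)) ` ({..<n} \<times> {k. 0 < k \<and> k < m \<and> p dvd k})"
proof -
  have "z \<in> \<mu> \<and> z \<noteq> 1 \<and> z ^ (m div p) = 1 \<longleftrightarrow> (\<exists>k. 0 < k \<and> k < m \<and> p dvd k \<and> z = \<theta> ^ k)" for z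
  proof
    assume z: "z \<in> \<mu> \<and> z \<noteq> 1 \<and> z ^ (m div p) = 1"
    then obtain k where "k < m" "z = \<theta> ^ k" using mu_exponent by blast
    then show "\<exists>k. 0 < k \<and> k < m \<and> p dvd k \<and> z = \<theta> ^ k"
      using z theta_pow_quotient_iff by (intro exI[of _ k]) (auto intro: Nat.gr0I)
  next
    assume "\<exists>k. 0 < k \<and> k < m \<and> p dvd k \<and> z = \<theta> ^ k"
    then show "z \<in> \<mu> \<and> z \<noteq> 1 \<and> z ^ (m div p) = 1"
      using theta_pow_quotient_iff by (auto simp: theta_pow_eq_1_iff dest!: dvd_imp_le[of m])
  qed
  then show ?thesis unfolding diag_reflections_def by (auto simp: image_iff)
qed

lemma swap_reflections_exponents:
  "swap_reflections = (\<lambda>((i, j), k). sref n i j (\<theta> ^ k)) ` ({(i, j). i < j \<and> j < n} \<times> {..<m})"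
proof -
  have ordered: "\<exists>i' j' k. i' < j' \<and> j' < n \<and> k < m \<and> sref n i j z = sref n i' j' (\<theta> ^ k)"
    if "i < n" "j < n" "i \<noteq> j" "z \<in> \<mu>" for i j z
  proof (cases "i < j")
    case True
    then show ?thesis using that mu_exponent by blast
  next
    case False
    have "inverse z \<in> \<mu>" using that by simp
    then obtain k where "k < m" "inverse z = \<theta> ^ k" using mu_exponent by blast
    moreover have "sref n i j z = sref n j i (inverse z)" using that sref_commute[of j i n z] by simp
    ultimately show ?thesis using that False by (intro exI[of _ j] exI[of _ i] exI[of _ k]) auto
  qed
  show ?thesis
  proof (intro equalityI subsetI)
    fix s assume "s \<in> swap_reflections"
    then obtain i j k where "i < j" "j < n" "k < m" "s = sref n i j (\<theta> ^ k)"
      unfolding swap_reflections_def using ordered by blast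
    then show "s \<in> (\<lambda>((i, j), k). sref n i j (\<theta> ^ k)) ` ({(i, j). i < j \<and> j < n} \<times> {..<m})"
      by (intro image_eqI[of _ _ "((i, j), k)"]) auto
  next
    fix s assume "s \<in> (\<lambda>((i, j), k). sref n i j (\<theta> ^ k)) ` ({(i, j). i < j \<and> j < n} \<times> {..<m})"
    then obtain i j k where "i < j" "j < n" "s = sref n i j (\<theta> ^ k)" by auto
    then show "s \<in> swap_reflections"
      unfolding swap_reflections_def mem_Collect_eq
      by (intro exI[of _ i] exI[of _ j] exI[of _ "\<theta> ^ k"]) auto
  qed
qed

lemma swap_refls_eq: "swap_refls m n \<theta> = swap_reflections"
proof (intro equalityI subsetI)
  fix s assume "s \<in> swap_refls m n \<theta>"
  then obtain i j k where "i < j" "j < n" "k < m" "s = swap_refl n \<theta> i j k"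
    by (auto simp: swap_refls_def)
  then show "s \<in> swap_reflections"
    unfolding swap_reflections_exponents
    by (intro image_eqI[of _ _ "((i, j), k)"]) (auto simp: swap_refl_eq_sref)
next
  fix s assume "s \<in> swap_reflections"
  then obtain i j k where "i < j" "j < n" "k < m" "s = sref n i j (\<theta> ^ k)"
    by (auto simp: swap_reflections_exponents)
  then show "s \<in> swap_refls m n \<theta>"
    unfolding swap_refls_def
    by (intro CollectI exI[of _ i] exI[of _ j] exI[of _ k]) (simp add: swap_refl_eq_sref)
qed

end

section \<open>The roots and the cocycle\<close>

context imprimitive_reflection_group
begin

lemma swap_root_ne_0:
  "i < n \<Longrightarrow> j < n \<Longrightarrow> i \<noteq> j \<Longrightarrow> unit_vec n i - a \<cdot>\<^sub>v unit_vec n j \<noteq> (0\<^sub>v n :: 'k vec)"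
  by (auto dest!: arg_cong[where f = "\<lambda>v. v $ i"] simp: unit_vec_def)

text \<open>The definite description of the root is meaningful because a reflection determines its family,
  its indices and its coefficient.\<close>

lemma refl_root_dref:
  assumes i: "i < n" and k: "0 < k" "k < m" "p dvd k"
  shows "refl_root m p n \<theta> (dref n i (\<theta> ^ k)) = unit_vec n i"
  unfolding refl_root_def
proof (rule the_equality)
  show "(\<exists>i' k'. i' < n \<and> 0 < k' \<and> k' < m \<and> p dvd k' \<and> dref n i (\<theta> ^ k) = diag_refl n \<theta> i' k' \<and>
        unit_vec n i = unit_vec n i') \<or>
      (\<exists>i' j' k'. i' < j' \<and> j' < n \<and> k' < m \<and> dref n i (\<theta> ^ k) = swap_refl n \<theta> i' j' k' \<and>
        unit_vec n i = unit_vec n i' - inverse (\<theta> ^ k') \<cdot>\<^sub>v unit_vec n j')"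
    using i k by (intro disjI1 exI[of _ i] exI[of _ k]) (simp add: diag_refl_eq_dref)
  have ne: "\<theta> ^ k \<noteq> 1" using k by (auto simp: theta_pow_eq_1_iff dest: dvd_imp_le)
  fix \<alpha>
  assume "(\<exists>i' k'. i' < n \<and> 0 < k' \<and> k' < m \<and> p dvd k' \<and> dref n i (\<theta> ^ k) = diag_refl n \<theta> i' k' \<and>
        \<alpha> = unit_vec n i') \<or>
      (\<exists>i' j' k'. i' < j' \<and> j' < n \<and> k' < m \<and> dref n i (\<theta> ^ k) = swap_refl n \<theta> i' j' k' \<and>
        \<alpha> = unit_vec n i' - inverse (\<theta> ^ k') \<cdot>\<^sub>v unit_vec n j')"
  then show "\<alpha> = unit_vec n i"
  proof (elim disjE exE conjE)
    fix i' k' assume "dref n i (\<theta> ^ k) = diag_refl n \<theta> i' k'" "\<alpha> = unit_vec n i'"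
    then show ?thesis using dref_eqD(1)[of i "\<theta> ^ k" i' "\<theta> ^ k'"] i ne by (simp add: diag_refl_eq_dref)
  next
    fix i' j' k' assume "i' < j'" "j' < n" "dref n i (\<theta> ^ k) = swap_refl n \<theta> i' j' k'"
    then show ?thesis using dref_ne_sref[of i' j' "\<theta> ^ k'" i "\<theta> ^ k"] by (simp add: swap_refl_eq_sref)
  qed
qed

lemma refl_root_sref:
  assumes ij: "i < j" "j < n" and k: "k < m"
  shows "refl_root m p n \<theta> (sref n i j (\<theta> ^ k)) = unit_vec n i - inverse (\<theta> ^ k) \<cdot>\<^sub>v unit_vec n j"
  unfolding refl_root_def
proof (rule the_equality)
  show "(\<exists>i' k'. i' < n \<and> 0 < k' \<and> k' < m \<and> p dvd k' \<and> sref n i j (\<theta> ^ k) = diag_refl n \<theta> i' k' \<and>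
        unit_vec n i - inverse (\<theta> ^ k) \<cdot>\<^sub>v unit_vec n j = unit_vec n i') \<or>
      (\<exists>i' j' k'. i' < j' \<and> j' < n \<and> k' < m \<and> sref n i j (\<theta> ^ k) = swap_refl n \<theta> i' j' k' \<and>
        unit_vec n i - inverse (\<theta> ^ k) \<cdot>\<^sub>v unit_vec n j =
        unit_vec n i' - inverse (\<theta> ^ k') \<cdot>\<^sub>v unit_vec n j')"
    using ij k by (intro disjI2 exI[of _ i] exI[of _ j] exI[of _ k]) (simp add: swap_refl_eq_sref)
  fix \<alpha>
  assume "(\<exists>i' k'. i' < n \<and> 0 < k' \<and> k' < m \<and> p dvd k' \<and> sref n i j (\<theta> ^ k) = diag_refl n \<theta> i' k' \<and>
        \<alpha> = unit_vec n i') \<or>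
      (\<exists>i' j' k'. i' < j' \<and> j' < n \<and> k' < m \<and> sref n i j (\<theta> ^ k) = swap_refl n \<theta> i' j' k' \<and>
        \<alpha> = unit_vec n i' - inverse (\<theta> ^ k') \<cdot>\<^sub>v unit_vec n j')"
  then show "\<alpha> = unit_vec n i - inverse (\<theta> ^ k) \<cdot>\<^sub>v unit_vec n j"
  proof (elim disjE exE conjE)
    fix i' k' assume "sref n i j (\<theta> ^ k) = diag_refl n \<theta> i' k'"
    then show ?thesis
      using dref_ne_sref[of i j "\<theta> ^ k" i' "\<theta> ^ k'"] ij by (simp add: diag_refl_eq_dref)
  next
    fix i' j' k' assume "i' < j'" "sref n i j (\<theta> ^ k) = swap_refl n \<theta> i' j' k'"
      "\<alpha> = unit_vec n i' - inverse (\<theta> ^ k') \<cdot>\<^sub>v unit_vec n j'"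
    then show ?thesis
      using sref_eqD[of i j "\<theta> ^ k" i' j' "\<theta> ^ k'"] ij by (simp add: swap_refl_eq_sref)
  qed
qed

lemma refl_root_properties:
  assumes "s \<in> S"
  shows "root_of n s (refl_root m p n \<theta> s)" "refl_root m p n \<theta> s \<noteq> 0\<^sub>v n"
proof -
  from assms consider i k where "s = dref n i (\<theta> ^ k)" "i < n" "0 < k" "k < m" "p dvd k"
    | i j k where "s = sref n i j (\<theta> ^ k)" "i < j" "j < n" "k < m"
    unfolding reflections_eq diag_reflections_exponents swap_reflections_exponents by auto
  then have "root_of n s (refl_root m p n \<theta> s) \<and> refl_root m p n \<theta> s \<noteq> 0\<^sub>v n"
  proof cases
    case 1
    then show ?thesis by (simp add: refl_root_dref root_of_dref)
  next
    case 2
    then show ?thesis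
      using root_of_sref[of i n j "\<theta> ^ k"] swap_root_ne_0[of i j] by (simp add: refl_root_sref)
  qed
  then show "root_of n s (refl_root m p n \<theta> s)" "refl_root m p n \<theta> s \<noteq> 0\<^sub>v n" by simp_all
qed

lemma refl_root_carrier: "s \<in> S \<Longrightarrow> refl_root m p n \<theta> s \<in> carrier_vec n"
  using refl_root_properties(1) by (simp add: root_of_def)

lemma contragredient_one: "\<alpha> \<in> carrier_vec n \<Longrightarrow> contragredient m p n \<theta> (1\<^sub>m n) \<alpha> = \<alpha>"
  using inv_one by (simp add: contragredient_def)

lemma contragredient_mult:
  assumes g: "g \<in> carrier G" and h: "h \<in> carrier G" and \<alpha>: "\<alpha> \<in> carrier_vec n"
  shows "contragredient m p n \<theta> (g * h) \<alpha> = contragredient m p n \<theta> g (contragredient m p n \<theta> h \<alpha>)"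
  using inv_mult_group[OF g h] inv_carrier_mat[OF g] inv_carrier_mat[OF h] \<alpha>
  by (simp add: contragredient_def transpose_mult[where nr = n and n = n and nc = n]
      assoc_mult_mat_vec[where n\<^sub>1 = n and n\<^sub>2 = n and n\<^sub>3 = n])

lemma lam_unique:
  assumes "contragredient m p n \<theta> g (refl_root m p n \<theta> s) =
      a \<cdot>\<^sub>v refl_root m p n \<theta> (conjugate_by m p n \<theta> g s)"
    and g: "g \<in> carrier G" and s: "s \<in> S"
  shows "lam m p n \<theta> g s = a"
  unfolding lam_def
proof (rule the_equality)
  let ?\<beta> = "refl_root m p n \<theta> (conjugate_by m p n \<theta> g s)"
  have \<beta>: "?\<beta> \<in> carrier_vec n" "?\<beta> \<noteq> 0\<^sub>v n"
    using S_conjugate[OF g s] refl_root_properties(2) refl_root_carrier by (simp_all add: conjugate_by_def)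
  then obtain r where r: "r < n" "?\<beta> $ r \<noteq> 0"
    by (metis carrier_vecD eq_vecI index_zero_vec)
  show "contragredient m p n \<theta> g (refl_root m p n \<theta> s) = a \<cdot>\<^sub>v ?\<beta>" by (rule assms(1))
  fix b assume "contragredient m p n \<theta> g (refl_root m p n \<theta> s) = b \<cdot>\<^sub>v ?\<beta>"
  then have "b \<cdot>\<^sub>v ?\<beta> = a \<cdot>\<^sub>v ?\<beta>" using assms(1) by simp
  then have "b * ?\<beta> $ r = a * ?\<beta> $ r" using r(1) \<beta>(1) by (metis carrier_vecD index_smult_vec(1))
  then show "b = a" using r(2) by simp
qed

text \<open>The covector \<open>g \<triangleright> \<alpha>\<^sub>s\<^sup>*\<close> is a root of \<open>g s g\<^sup>-\<^sup>1\<close>, and so is the chosen one.\<close>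

lemma lam_spec:
  assumes g: "g \<in> carrier G" and s: "s \<in> S"
  shows "contragredient m p n \<theta> g (refl_root m p n \<theta> s) =
      lam m p n \<theta> g s \<cdot>\<^sub>v refl_root m p n \<theta> (conjugate_by m p n \<theta> g s)"
proof -
  let ?t = "conjugate_by m p n \<theta> g s"
  have t: "?t \<in> S" using S_conjugate[OF g s] by (simp add: conjugate_by_def)
  have s': "s \<in> carrier_mat n n" and t': "?t \<in> carrier_mat n n"
    using s t S_subset carrier_subset by blast+
  have "root_of n ?t (contragredient m p n \<theta> g (refl_root m p n \<theta> s))"
    unfolding conjugate_by_def contragredient_def
    by (rule root_of_conjugate[OF s' carrier_subset[OF g] inv_carrier_mat[OF g] mult_inv(1)[OF g]
          refl_root_properties(1)[OF s]])
  moreover have "?t \<noteq> 1\<^sub>m n" using t S_subset reflection_iff_root by blast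
  ultimately obtain a where "contragredient m p n \<theta> g (refl_root m p n \<theta> s) = a \<cdot>\<^sub>v refl_root m p n \<theta> ?t"
    using root_of_unique[OF _ refl_root_properties(1)[OF t] t'] by blast
  then show ?thesis using lam_unique[OF _ g s] by metis
qed

sublocale cc: conjugation_cocycle G S "lam m p n \<theta>"
proof
  show "S \<subseteq> carrier G" by (rule S_subset)
  show "g \<otimes>\<^bsub>G\<^esub> s \<otimes>\<^bsub>G\<^esub> inv\<^bsub>G\<^esub> g \<in> S" if "g \<in> carrier G" "s \<in> S" for g s
    using S_conjugate[OF that] by simp
  show "lam m p n \<theta> \<one>\<^bsub>G\<^esub> s = 1" if s: "s \<in> S" for s
  proof (rule lam_unique[OF _ one_closed s])
    have "conjugate_by m p n \<theta> (1\<^sub>m n) s = s"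
      using inv_one carrier_subset[OF subsetD[OF S_subset s]] by (simp add: conjugate_by_def)
    then show "contragredient m p n \<theta> \<one>\<^bsub>G\<^esub> (refl_root m p n \<theta> s) =
        1 \<cdot>\<^sub>v refl_root m p n \<theta> (conjugate_by m p n \<theta> \<one>\<^bsub>G\<^esub> s)"
      using refl_root_carrier[OF s] by (simp add: contragredient_one)
  qed
  show "lam m p n \<theta> (g \<otimes>\<^bsub>G\<^esub> h) s = lam m p n \<theta> g (h \<otimes>\<^bsub>G\<^esub> s \<otimes>\<^bsub>G\<^esub> inv\<^bsub>G\<^esub> h) * lam m p n \<theta> h s"
    if g: "g \<in> carrier G" and h: "h \<in> carrier G" and s: "s \<in> S" for g h s
  proof (rule lam_unique[OF _ m_closed[OF g h] s])
    let ?t = "conjugate_by m p n \<theta> h s"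
    have t: "?t \<in> S" using S_conjugate[OF h s] by (simp add: conjugate_by_def)
    have s': "s \<in> carrier G" using s S_subset by blast
    have conj: "conjugate_by m p n \<theta> (g * h) s = conjugate_by m p n \<theta> g ?t"
      using inv_mult_group[OF g h] m_assoc g h s' m_closed inv_closed
      by (simp add: conjugate_by_def)
    have scale: "contragredient m p n \<theta> g (a \<cdot>\<^sub>v \<alpha>) = a \<cdot>\<^sub>v contragredient m p n \<theta> g \<alpha>"
      if "\<alpha> \<in> carrier_vec n" for a \<alpha>
      using that inv_carrier_mat[OF g] unfolding contragredient_def by (intro mult_mat_vec[of _ n n]) auto
    have "contragredient m p n \<theta> (g * h) (refl_root m p n \<theta> s) =
        lam m p n \<theta> h s \<cdot>\<^sub>v (lam m p n \<theta> g ?t \<cdot>\<^sub>v refl_root m p n \<theta> (conjugate_by m p n \<theta> g ?t))"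
      using g h s t by (simp add: contragredient_mult refl_root_carrier lam_spec scale)
    then show "contragredient m p n \<theta> (g \<otimes>\<^bsub>G\<^esub> h) (refl_root m p n \<theta> s) =
        (lam m p n \<theta> g (h \<otimes>\<^bsub>G\<^esub> s \<otimes>\<^bsub>G\<^esub> inv\<^bsub>G\<^esub> h) * lam m p n \<theta> h s) \<cdot>\<^sub>v
        refl_root m p n \<theta> (conjugate_by m p n \<theta> (g \<otimes>\<^bsub>G\<^esub> h) s)"
      by (simp add: conj smult_smult_assoc mult.commute) (simp add: conjugate_by_def)
  qed
qed

lemma Y_eqs:
  "Y_space m p n \<theta> = supported S" "Y_act m p n \<theta> = cc.act" "Y_coact = cc.coact"
  by (auto simp: Y_space_def supported_def Y_act_def cc.act_def cc.conj_def conjugate_by_def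
      Y_coact_def cc.coact_def rvec_def fun_eq_iff)

lemma rvec_span: "pm_span (rvec ` A) = supported A"
  using span_singles[of A] by (simp add: rvec_def)

end

section \<open>Exponents of given order\<close>

lemma dvd_mult_iff_order_dvd:
  fixes k m t :: nat
  assumes "0 < m"
  shows "m dvd t * k \<longleftrightarrow> m div gcd k m dvd t"
proof -
  define d where "d = gcd k m"
  have "d > 0" using assms by (simp add: d_def)
  then obtain k' m' where k': "k = k' * d" and m': "m = m' * d" and "coprime k' m'"
    using gcd_coprime_exists[of k m, folded d_def] by blast
  then have "m dvd t * k \<longleftrightarrow> m' dvd t * k'"
    unfolding k' m' by (simp flip: mult.assoc) (use \<open>d > 0\<close> in simp)
  also have "\<dots> \<longleftrightarrow> m' dvd t"
    using \<open>coprime k' m'\<close> by (simp add: coprime_dvd_mult_left_iff coprime_commute)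
  also have "m' = m div d" using m' \<open>d > 0\<close> by simp
  finally show ?thesis by (simp add: d_def)
qed

lemma ord_integer_mod_group:
  assumes "k < m"
  shows "group.ord (integer_mod_group m) (int k) = m div gcd k m"
proof (rule dvd_antisym)
  have k: "int k \<in> carrier (integer_mod_group m)"
    using assms by (simp add: carrier_integer_mod_group)
  have iff: "group.ord (integer_mod_group m) (int k) dvd t \<longleftrightarrow> m div gcd k m dvd t" for t
  proof -
    have "group.ord (integer_mod_group m) (int k) dvd t \<longleftrightarrow> (int t * int k) mod int m = 0"
      using group.pow_eq_id[OF group_integer_mod_group k, of t] by simp
    also have "\<dots> \<longleftrightarrow> m dvd t * k"
      by (metis mod_eq_0_iff_dvd of_nat_dvd_iff of_nat_mult)
    also have "\<dots> \<longleftrightarrow> m div gcd k m dvd t"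
      using assms by (intro dvd_mult_iff_order_dvd) simp
    finally show ?thesis .
  qed
  show "group.ord (integer_mod_group m) (int k) dvd m div gcd k m"
    by (rule iffD2[OF iff]) simp
  show "m div gcd k m dvd group.ord (integer_mod_group m) (int k)"
    by (rule iffD1[OF iff]) simp
qed

lemma exponents_of_order_eq: "exponents_of_order m d = {k. k < m \<and> m div gcd k m = d}"
  by (auto simp: exponents_of_order_def ord_integer_mod_group)

lemma card_exponents_of_order:
  assumes "0 < m" "d dvd m" "1 < d"
  shows "card (exponents_of_order m d) = totient d"
proof -
  obtain e where e: "m = d * e" using assms(2) by blast
  then have "0 < e" "0 < d" using assms by auto
  have "m div gcd k m = d \<longleftrightarrow> gcd k m = e" for k
  proof -
    obtain c where c: "m = gcd k m * c" by (meson dvdE gcd_dvd2)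
    moreover have "gcd k m > 0" using assms by simp
    ultimately have "m div gcd k m = c" by (metis nonzero_mult_div_cancel_left not_less0)
    then show ?thesis
      using c e \<open>0 < d\<close> \<open>0 < e\<close> \<open>gcd k m > 0\<close> by (metis mult.commute mult_cancel1 not_less0)
  qed
  \<comment> \<open>The representatives \<open>0\<close> and \<open>m\<close> of the zero class have order \<open>1\<close>, so neither side contains them.\<close>
  then have "exponents_of_order m d = {k \<in> {0<..m}. gcd k m = e}"
    unfolding exponents_of_order_eq using e assms \<open>0 < e\<close>
    by (auto intro: Nat.gr0I simp: le_less)
  then have "card (exponents_of_order m d) = totient (m div e)"
    using card_gcd_eq_totient[of m e] assms(1) e by simp
  then show ?thesis using e \<open>0 < e\<close> by simp
qed

lemma card_ordered_pairs: "2 * card {(i, j). i < j \<and> j < (n :: nat)} = n * (n - 1)"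
proof -
  have "{(i, j). i < j \<and> j < n} = prod.swap ` (SIGMA j:{..<n}. {..<j})" by auto
  then have "card {(i, j). i < j \<and> j < n} = (\<Sum>j<n. j)"
    by (simp add: card_image)
  moreover have "2 * (\<Sum>j<n. j) = n * (n - 1)"
    by (induction n) (auto simp: algebra_simps, (case_tac n; simp)?)
  ultimately show ?thesis by simp
qed

section \<open>The conjugacy classes of reflections\<close>

context imprimitive_reflection_group
begin

lemma conj_dref:
  assumes "\<sigma> permutes {..<n}" "admissible c" "i < n" "z \<in> \<mu>" "z ^ (m div p) = 1"
  shows "cc.conj (monomial n \<sigma> c) (dref n i z) = dref n (\<sigma> i) z"
  using conjugate_eqI[OF carrier_monomial dref_carrier monomial_mult_dref] assms
  by (simp add: cc.conj_def permutes_lt)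

lemma conj_sref:
  assumes \<sigma>: "\<sigma> permutes {..<n}" and c: "admissible c" and ij: "i < n" "j < n" "i \<noteq> j" and z: "z \<in> \<mu>"
  shows "cc.conj (monomial n \<sigma> c) (sref n i j z) = sref n (\<sigma> i) (\<sigma> j) (z * c j / c i)"
proof -
  have mem: "c i \<in> \<mu>" "c j \<in> \<mu>" using c ij by (simp_all add: admissible_def)
  have "\<sigma> i \<noteq> \<sigma> j" using permutes_inj[OF \<sigma>] ij by (auto dest: injD)
  then have "sref n (\<sigma> i) (\<sigma> j) (z * c j / c i) \<in> carrier G"
    using permutes_lt[OF \<sigma>] ij z mem by (intro sref_carrier) auto
  then show ?thesis
    using conjugate_eqI[OF carrier_monomial[OF \<sigma> c]] monomial_mult_sref[of \<sigma> n i j c z] \<sigma> ij z mem mu_nonzero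
    by (simp add: cc.conj_def)
qed

definition diag_class :: "nat \<Rightarrow> 'k mat set" where
  "diag_class k = (\<lambda>i. dref n i (\<theta> ^ k)) ` {..<n}"

definition diag_exponents :: "nat set" where
  "diag_exponents = {k. 0 < k \<and> k < m \<and> p dvd k}"

lemma diag_exponent_ne_one: "k \<in> diag_exponents \<Longrightarrow> \<theta> ^ k \<noteq> 1"
  by (auto simp: diag_exponents_def theta_pow_eq_1_iff dest: dvd_imp_le)

lemma diag_reflections_eq: "diag_reflections = \<Union> (diag_class ` diag_exponents)"
  unfolding diag_reflections_exponents diag_class_def diag_exponents_def by (auto simp: image_iff)

lemma inj_dref: "k \<in> diag_exponents \<Longrightarrow> inj_on (\<lambda>i. dref n i (\<theta> ^ k)) {..<n}"
  using dref_eqD(1)[OF _ _ diag_exponent_ne_one] by (intro inj_onI) simp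

lemma card_diag_class: "k \<in> diag_exponents \<Longrightarrow> card (diag_class k) = n"
  unfolding diag_class_def by (simp add: card_image inj_dref)

lemma diag_class_disjoint:
  assumes "j \<in> diag_exponents" "k \<in> diag_exponents" "j \<noteq> k"
  shows "diag_class j \<inter> diag_class k = {}"
proof (rule ccontr)
  assume "diag_class j \<inter> diag_class k \<noteq> {}"
  then obtain i i' where "dref n i (\<theta> ^ j) = dref n i' (\<theta> ^ k)" "i < n"
    by (auto simp: diag_class_def)
  then have "\<theta> ^ j = \<theta> ^ k" by (rule dref_eqD(2)) (use diag_exponent_ne_one[OF assms(1)] in simp_all)
  then show False using theta_pow_eqD assms by (auto simp: diag_exponents_def)
qed

lemma diag_class_nonempty: "diag_class k \<noteq> {}"
  using n_ge_2 by (simp add: diag_class_def lessThan_empty_iff)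

lemma inj_diag_class: "inj_on diag_class diag_exponents"
  using diag_class_disjoint diag_class_nonempty by (intro inj_onI) (metis inf.idem)

lemma finite_diag_exponents: "finite diag_exponents"
  by (auto simp: diag_exponents_def intro: finite_subset[of _ "{..<m}"])

lemma card_diag_exponents: "card diag_exponents = m div p - 1"
proof -
  have "diag_exponents = (\<lambda>t. p * t) ` {0<..<m div p}"
  proof (intro equalityI subsetI)
    fix k assume "k \<in> diag_exponents"
    then obtain t where t: "k = p * t" "0 < p * t" "p * t < p * (m div p)"
      using p_dvd_m by (auto simp: diag_exponents_def elim: dvdE)
    then show "k \<in> (\<lambda>t. p * t) ` {0<..<m div p}" by (auto intro!: imageI)
  next
    fix k assume "k \<in> (\<lambda>t. p * t) ` {0<..<m div p}"
    then obtain t where "t \<in> {0<..<m div p}" and k: "k = p * t" by blast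
    then have t: "0 < t" "t < m div p" by simp_all
    then have "p * t < p * (m div p)" using p_pos by simp
    then show "k \<in> diag_exponents" using t k p_pos p_dvd_m by (simp add: diag_exponents_def)
  qed
  then show ?thesis using p_pos by (simp add: card_image inj_on_def)
qed

lemma card_diag_reflections: "card diag_reflections = n * (m div p - 1)"
proof -
  have "card diag_reflections = (\<Sum>k\<in>diag_exponents. card (diag_class k))"
    unfolding diag_reflections_eq
    using diag_class_disjoint finite_diag_exponents
    by (intro card_UN_disjoint) (auto simp: diag_class_def)
  then show ?thesis by (simp add: card_diag_class card_diag_exponents)
qed

lemma finite_swap_reflections: "finite swap_reflections"
  unfolding swap_reflections_exponents
  by (intro finite_imageI finite_cartesian_product finite_subset[of "{(i, j). i < j \<and> j < n}" "{..<n} \<times> {..<n}"]) auto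

lemma card_swap_reflections: "2 * card swap_reflections = m * (n * (n - 1))"
proof -
  have "inj_on (\<lambda>((i, j), k). sref n i j (\<theta> ^ k)) ({(i, j). i < j \<and> j < n} \<times> {..<m})"
  proof (rule inj_onI, clarsimp)
    fix i j k i' j' k'
    assume "k < m" "k' < m" "i < j" "j < n" "i' < j'" "sref n i j (\<theta> ^ k) = sref n i' j' (\<theta> ^ k')"
    then show "i = i' \<and> j = j' \<and> k = k'"
      using sref_eqD[of i j "\<theta> ^ k" i' j' "\<theta> ^ k'"] theta_pow_eqD[of k k'] by simp
  qed
  then have "card swap_reflections = card {(i, j). i < j \<and> j < n} * m"
    unfolding swap_reflections_exponents by (simp add: card_image card_cartesian_product)
  then have "2 * card swap_reflections = m * (2 * card {(i, j). i < j \<and> j < n})" by simp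
  then show ?thesis by (simp only: card_ordered_pairs)
qed

lemma diag_swap_disjoint: "diag_reflections \<inter> swap_reflections = {}"
  by (auto simp: diag_reflections_def swap_reflections_def dref_ne_sref mu_nonzero)

lemma finite_diag_reflections: "finite diag_reflections"
  unfolding diag_reflections_eq using finite_diag_exponents by (auto simp: diag_class_def)

lemma conj_class_diag:
  assumes k: "k \<in> diag_exponents"
  shows "cc.conj_class (diag_class k)"
  unfolding cc.conj_class_def
proof (intro conjI ballI)
  have z: "\<theta> ^ k \<in> \<mu>" "(\<theta> ^ k) ^ (m div p) = 1"
    using k theta_pow_quotient_iff by (simp_all add: diag_exponents_def)
  show "diag_class k \<noteq> {}" by (rule diag_class_nonempty)
  show "diag_class k \<subseteq> S" using k unfolding reflections_eq diag_reflections_eq by blast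
  show "cc.conj g s \<in> diag_class k" if g: "g \<in> carrier G" and s: "s \<in> diag_class k" for g s
  proof -
    obtain \<sigma> c where "g = monomial n \<sigma> c" "\<sigma> permutes {..<n}" "admissible c" by (rule carrierE[OF g])
    then show ?thesis using s z conj_dref permutes_lt by (auto simp: diag_class_def)
  qed
  show "\<exists>g\<in>carrier G. cc.conj g s = t" if "s \<in> diag_class k" "t \<in> diag_class k" for s t
  proof -
    obtain i j where ij: "s = dref n i (\<theta> ^ k)" "t = dref n j (\<theta> ^ k)" "i < n" "j < n"
      using \<open>s \<in> diag_class k\<close> \<open>t \<in> diag_class k\<close> by (auto simp: diag_class_def)
    have \<sigma>: "Transposition.transpose i j permutes {..<n}" using ij by (intro permutes_swap_id) auto
    show ?thesis
      using conj_dref[OF \<sigma> admissible_one ij(3) z] carrier_monomial[OF \<sigma> admissible_one] ij by auto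
  qed
qed

lemma permutation_of_two_points:
  fixes i j i' j' :: nat
  assumes "i < n" "j < n" "i \<noteq> j" "i' < n" "j' < n" "i' \<noteq> j'"
  shows "\<exists>\<sigma>. \<sigma> permutes {..<n} \<and> \<sigma> i = i' \<and> \<sigma> j = j'"
proof -
  let ?\<tau> = "Transposition.transpose i i'"
  have \<tau>: "?\<tau> permutes {..<n}" using assms by (intro permutes_swap_id) auto
  then have "Transposition.transpose (?\<tau> j) j' permutes {..<n}"
    using assms permutes_lt[OF \<tau>] by (intro permutes_swap_id) auto
  then have "Transposition.transpose (?\<tau> j) j' \<circ> ?\<tau> permutes {..<n}"
    using \<tau> by (rule permutes_compose[rotated])
  moreover have "?\<tau> j \<noteq> i'" using assms by (auto simp: Transposition.transpose_def)
  ultimately show ?thesis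
    using assms by (intro exI[of _ "Transposition.transpose (?\<tau> j) j' \<circ> ?\<tau>"]) simp
qed

text \<open>A diagonal matrix with coefficients \<open>c\<close> multiplies the coefficient of \<open>sref n i j z\<close> by
  \<open>c\<^sub>j / c\<^sub>i\<close>. Any value in \<open>\<mu>\<close> is possible: a third coordinate can repair the product of the
  \<open>c\<^sub>l\<close>, and for odd \<open>p\<close> the values \<open>c\<^sub>i = \<theta>\<^bsup>e(p-1)/2\<^esup>\<close>, \<open>c\<^sub>j = \<theta>\<^bsup>e(p+1)/2\<^esup>\<close> have quotient \<open>\<theta>\<^bsup>e\<^esup>\<close> and
  product \<open>\<theta>\<^bsup>ep\<^esup>\<close>.\<close>

lemma admissible_quotient:
  assumes "3 \<le> n \<or> odd p" and ij: "i < n" "j < n" "i \<noteq> j" and w: "w \<in> \<mu>"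
  shows "\<exists>c. admissible c \<and> c j / c i = w"
  using assms(1)
proof
  assume "3 \<le> n"
  have "\<exists>l<n. l \<noteq> i \<and> l \<noteq> j"
  proof (rule ccontr)
    assume "\<not> ?thesis"
    then have "{..<n} \<subseteq> {i, j}" by auto
    then have "n \<le> card {i, j}" using card_mono[of "{i, j}" "{..<n}"] by simp
    then show False using \<open>3 \<le> n\<close> ij(3) by simp
  qed
  then obtain l where "l < n" "l \<noteq> i" "l \<noteq> j" by blast
  then show ?thesis
    using ij w mu_nonzero[OF w]
    by (intro exI[of _ "\<lambda>x. if x = j then w else if x = l then inverse w else 1"])
       (auto simp: admissible_def prod_two_point)
next
  assume "odd p"
  then obtain h where h: "p = 2 * h + 1" by (elim oddE)
  obtain e where e: "w = \<theta> ^ e" using w mu_exponent by blast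
  let ?c = "\<lambda>x. if x = i then \<theta> ^ (e * h) else if x = j then \<theta> ^ (e * h + e) else 1"
  have "(\<Prod>l<n. ?c l) = \<theta> ^ (e * p)"
    using ij by (simp add: prod_two_point h mult_2 mult_2_right algebra_simps flip: power_add)
  then have "admissible ?c"
    using theta_pow_quotient_iff[of "e * p"] by (simp add: admissible_def)
  moreover have "?c j / ?c i = w" using ij by (simp add: e power_add)
  ultimately show ?thesis by blast
qed

lemma conj_class_swap:
  assumes "3 \<le> n \<or> odd p"
  shows "cc.conj_class swap_reflections"
  unfolding cc.conj_class_def
proof (intro conjI ballI)
  have "sref n 0 1 1 \<in> swap_reflections"
    unfolding swap_reflections_def mem_Collect_eq
    by (intro exI[of _ 0] exI[of _ 1] exI[of _ "1 :: 'k"]) (use n_ge_2 in auto)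
  then show "swap_reflections \<noteq> {}" by blast
  show "swap_reflections \<subseteq> S" unfolding reflections_eq by blast
  show "cc.conj g s \<in> swap_reflections" if gG: "g \<in> carrier G" and sX: "s \<in> swap_reflections" for g s
  proof -
    obtain \<sigma> c where g: "g = monomial n \<sigma> c" and \<sigma>: "\<sigma> permutes {..<n}" and c: "admissible c"
      by (rule carrierE[OF gG])
    obtain i j z where s: "s = sref n i j z" and ij: "i < n" "j < n" "i \<noteq> j" and z: "z \<in> \<mu>"
      using sX unfolding swap_reflections_def by blast
    have "\<sigma> i \<noteq> \<sigma> j" using permutes_inj[OF \<sigma>] ij by (auto dest: injD)
    moreover have "z * c j / c i \<in> \<mu>" using c ij z by (simp add: admissible_def)
    ultimately show ?thesis
      unfolding g s conj_sref[OF \<sigma> c ij z] swap_reflections_def mem_Collect_eq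
      using ij permutes_lt[OF \<sigma>] by blast
  qed
  show "\<exists>g\<in>carrier G. cc.conj g s = t" if sX: "s \<in> swap_reflections" and tX: "t \<in> swap_reflections" for s t
  proof -
    obtain i j z where s: "s = sref n i j z" and ij: "i < n" "j < n" "i \<noteq> j" and z: "z \<in> \<mu>"
      using sX unfolding swap_reflections_def by blast
    obtain i' j' z' where t: "t = sref n i' j' z'" and ij': "i' < n" "j' < n" "i' \<noteq> j'" and z': "z' \<in> \<mu>"
      using tX unfolding swap_reflections_def by blast
    obtain \<sigma> where \<sigma>: "\<sigma> permutes {..<n}" "\<sigma> i = i'" "\<sigma> j = j'"
      using permutation_of_two_points[OF ij ij'] by blast
    obtain c where c: "admissible c" "c j / c i = z' / z"
      using admissible_quotient[OF assms ij, of "z' / z"] z z' by auto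
    have "z * c j / c i = z * (c j / c i)" by simp
    also have "\<dots> = z'" using c(2) mu_nonzero[OF z] by simp
    finally have "z * c j / c i = z'" .
    then show ?thesis
      using conj_sref[OF \<sigma>(1) c(1) ij z] carrier_monomial[OF \<sigma>(1) c(1)] s t \<sigma> by auto
  qed
qed

text \<open>For \<open>n = 2\<close> and \<open>m = 2a\<close>, the value of \<open>z\<^sup>a = \<plusminus>1\<close> is the parity of the exponent of \<open>z\<close>.\<close>

definition parity_class :: "bool \<Rightarrow> 'k mat set" where
  "parity_class e = {sref 2 0 1 z | z. z \<in> \<mu> \<and> (z ^ (m div 2) = 1 \<longleftrightarrow> e)}"

lemma theta_pow_half:
  assumes "even m"
  shows "(\<theta> ^ k) ^ (m div 2) = 1 \<longleftrightarrow> even k"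
proof -
  obtain a where "m = 2 * a" using assms by blast
  then show ?thesis using m_pos by (simp add: theta_pow_eq_1_iff flip: power_mult)
qed

text \<open>If \<open>p\<close> is even then \<open>m/2\<close> is a multiple of \<open>m/p\<close>, so the product of the coefficients of an
  element has trivial \<open>m/2\<close>-th power. As \<open>c\<^sub>0\<close> has trivial \<open>m\<close>-th power, \<open>c\<^sub>0\<close> and \<open>c\<^sub>1\<close> have the same
  \<open>m/2\<close>-th power, so conjugation preserves the parity.\<close>

lemma admissible_quotient_even:
  assumes "n = 2" "even p" and c: "admissible c"
  shows "(c 1 / c 0) ^ (m div 2) = 1"
proof -
  obtain b where b: "p = 2 * b" using assms(2) by blast
  obtain q where q: "m = p * q" using p_dvd_m by blast
  then have "m div p = q" "m div 2 = q * b" "m = m div 2 + m div 2" using p_pos b by simp_all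
  have mem: "c 0 \<in> \<mu>" "c 1 \<in> \<mu>" using c n_ge_2 by (auto simp: admissible_def)
  have "(\<Prod>i<n. c i) = c 0 * c 1" using \<open>n = 2\<close> by (simp add: numeral_2_eq_2)
  then have "(c 0 * c 1) ^ (m div 2) = 1"
    using c \<open>m div p = q\<close> \<open>m div 2 = q * b\<close> by (simp add: admissible_def power_mult)
  moreover have "c 0 ^ (m div 2) * c 0 ^ (m div 2) = 1"
    using mu_pow_m[OF mem(1)] \<open>m = m div 2 + m div 2\<close> by (metis power_add)
  ultimately have "c 0 ^ (m div 2) * c 1 ^ (m div 2) = c 0 ^ (m div 2) * c 0 ^ (m div 2)"
    by (simp add: power_mult_distrib)
  then have "c 1 ^ (m div 2) = c 0 ^ (m div 2)" using mu_nonzero[OF mem(1)] by simp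
  then show ?thesis using mu_nonzero[OF mem(1)] by (simp add: power_divide)
qed

lemma swap_reflections_parity:
  assumes "n = 2"
  shows "swap_reflections = parity_class True \<union> parity_class False"
proof -
  have "{(i, j). i < j \<and> j < n} = {(0, 1)}" using assms by auto
  moreover have "{(0 :: nat, 1 :: nat)} \<times> {..<m} = (\<lambda>k. ((0, 1), k)) ` {..<m}" by blast
  ultimately have "swap_reflections = (\<lambda>k. sref 2 0 1 (\<theta> ^ k)) ` {..<m}"
    unfolding swap_reflections_exponents using assms by (simp add: image_image)
  also have "\<dots> = {sref 2 0 1 z | z. z \<in> \<mu>}"
    using mu_exponent mu_theta by blast
  finally show ?thesis by (auto simp: parity_class_def)
qed

lemma parity_class_disjoint:
  assumes "n = 2"
  shows "parity_class True \<inter> parity_class False = {}"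
proof (rule ccontr)
  assume "\<not> ?thesis"
  then obtain z w where "sref 2 0 1 z = sref 2 0 1 w" "z \<in> \<mu>" "z ^ (m div 2) = 1" "w ^ (m div 2) \<noteq> 1"
    by (auto simp: parity_class_def)
  moreover from this have "z = w"
    using sref_eqD(3)[of 0 1 z 0 1 w] mu_nonzero[of z] assms by simp
  ultimately show False by simp
qed

text \<open>Two coefficients of the same parity differ by a factor \<open>\<theta>\<^bsup>2h\<^esup>\<close>, which is the quotient of the
  coefficients \<open>\<theta>\<^sup>h\<close> and \<open>\<theta>\<^bsup>-h\<^esup>\<close> of a diagonal matrix of determinant one.\<close>

lemma conj_class_parity:
  assumes n: "n = 2" and p: "even p"
  shows "cc.conj_class (parity_class e)"
  unfolding cc.conj_class_def
proof (intro conjI ballI)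
  have m: "even m" using p p_dvd_m by (rule dvd_trans)
  define z0 where "z0 = \<theta> ^ (if e then 0 else 1 :: nat)"
  have "z0 ^ (m div 2) = 1 \<longleftrightarrow> e" unfolding z0_def theta_pow_half[OF m] by simp
  moreover have "z0 \<in> \<mu>" by (simp add: z0_def del: power_0 power_one_right)
  ultimately have "sref 2 0 1 z0 \<in> parity_class e" unfolding parity_class_def by blast
  then show "parity_class e \<noteq> {}" by blast
  show "parity_class e \<subseteq> S"
    unfolding reflections_eq swap_reflections_parity[OF n] by (cases e) auto
  show "cc.conj g s \<in> parity_class e" if gG: "g \<in> carrier G" and sX: "s \<in> parity_class e" for g s
  proof -
    obtain \<sigma> c where g: "g = monomial n \<sigma> c" and \<sigma>: "\<sigma> permutes {..<n}" and c: "admissible c"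
      by (rule carrierE[OF gG])
    obtain z where s: "s = sref 2 0 1 z" and z: "z \<in> \<mu>" "z ^ (m div 2) = 1 \<longleftrightarrow> e"
      using sX unfolding parity_class_def by blast
    define w where "w = z * c 1 / c 0"
    have w_eq: "w = z * (c 1 / c 0)" by (simp add: w_def)
    have "c 0 \<in> \<mu>" "c 1 \<in> \<mu>" using c n_ge_2 by (auto simp: admissible_def)
    then have w: "w \<in> \<mu>" using z by (simp add: w_eq)
    have w': "w ^ (m div 2) = 1 \<longleftrightarrow> e"
      unfolding w_eq power_mult_distrib admissible_quotient_even[OF n p c] using z by simp
    have conj: "cc.conj g s = sref 2 (\<sigma> 0) (\<sigma> 1) w"
      using conj_sref[OF \<sigma> c _ _ _ z(1), of 0 1] n by (simp add: g s w_def)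
    have "\<sigma> 0 < 2" "\<sigma> 1 < 2" "\<sigma> 0 \<noteq> \<sigma> 1"
      using permutes_lt[OF \<sigma>] permutes_inj[OF \<sigma>] n by (auto dest: injD)
    then consider "\<sigma> 0 = 0" "\<sigma> 1 = 1" | "\<sigma> 0 = 1" "\<sigma> 1 = 0" by linarith
    then show ?thesis
    proof cases
      case 1
      then show ?thesis using w w' by (auto simp: conj parity_class_def)
    next
      case 2
      then have "cc.conj g s = sref 2 0 1 (inverse w)" using conj sref_commute[of 0 1 2 w] by simp
      moreover have "inverse w ^ (m div 2) = 1 \<longleftrightarrow> e" using w' by (simp add: power_inverse)
      ultimately show ?thesis using w by (auto simp: parity_class_def)
    qed
  qed
  show "\<exists>g\<in>carrier G. cc.conj g s = t" if sX: "s \<in> parity_class e" and tX: "t \<in> parity_class e" for s t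
  proof -
    obtain z where s: "s = sref 2 0 1 z" and z: "z \<in> \<mu>" "z ^ (m div 2) = 1 \<longleftrightarrow> e"
      using sX unfolding parity_class_def by blast
    obtain w where t: "t = sref 2 0 1 w" and w: "w \<in> \<mu>" "w ^ (m div 2) = 1 \<longleftrightarrow> e"
      using tX unfolding parity_class_def by blast
    obtain j where j: "z = \<theta> ^ j" using z(1) mu_exponent by blast
    obtain k where k: "w = \<theta> ^ k" using w(1) mu_exponent by blast
    obtain l where l: "w / z = \<theta> ^ l" using mu_exponent[of "w / z"] z(1) w(1) by auto
    have "\<theta> ^ (l + j) = \<theta> ^ k" using j k l by (simp add: power_add field_simps)
    then have "even (l + j) \<longleftrightarrow> even k" using theta_pow_half[OF m] by metis
    moreover have "even j \<longleftrightarrow> even k" using z(2) w(2) j k theta_pow_half[OF m] by simp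
    ultimately have "even l" by (simp only: even_add) blast
    then obtain h where h: "l = h + h" by (metis evenE mult_2)
    let ?c = "\<lambda>x :: nat. if x = 0 then inverse (\<theta> ^ h) else if x = 1 then \<theta> ^ h else 1"
    have "(\<Prod>l<n. ?c l) = inverse (\<theta> ^ h) * \<theta> ^ h"
      using n_ge_2 by (intro prod_two_point) auto
    then have c: "admissible ?c" by (simp add: admissible_def)
    have "z * ?c 1 / ?c 0 = w"
      using l mu_nonzero[OF z(1)] by (simp add: h power_add field_simps)
    then have "cc.conj (monomial n id ?c) s = t"
      using conj_sref[OF permutes_id c _ _ _ z(1), of 0 1] n s t by simp
    then show ?thesis using carrier_monomial[OF permutes_id c] by blast
  qed
qed

text \<open>The part of the decomposition that is common to all cases: one summand for each exponent of a
  diagonal reflection, next to the classes into which the swaps split.\<close>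

lemma simple_decomposition_of_swap_classes:
  assumes fin: "finite \<B>" and classes: "\<And>B. B \<in> \<B> \<Longrightarrow> cc.conj_class B" and B: "\<Union>\<B> = swap_reflections"
  shows "cc.yd.simple_decomposition (supported ` \<B> \<union> supported ` diag_class ` diag_exponents)"
    and "cc.yd.rank = card \<B> + (m div p - 1)"
proof -
  let ?A = "\<B> \<union> diag_class ` diag_exponents"
  have finA: "finite ?A" using fin finite_diag_exponents by simp
  have classA: "cc.conj_class A" if "A \<in> ?A" for A using that classes conj_class_diag by blast
  have unionA: "\<Union>?A = S" using B by (auto simp: reflections_eq diag_reflections_eq)
  show "cc.yd.simple_decomposition (supported ` \<B> \<union> supported ` diag_class ` diag_exponents)"
    using cc.simple_decomposition_conj_classes(1)[OF finA classA unionA] by (simp add: image_Un)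
  have "B \<notin> diag_class ` diag_exponents" if "B \<in> \<B>" for B
  proof
    assume "B \<in> diag_class ` diag_exponents"
    then have "B \<subseteq> diag_reflections \<inter> swap_reflections" "B \<noteq> {}"
      using that B diag_class_nonempty by (auto simp: diag_reflections_eq)
    then show False using diag_swap_disjoint by blast
  qed
  then have "card ?A = card \<B> + card (diag_class ` diag_exponents)"
    using fin finite_diag_exponents by (intro card_Un_disjoint) auto
  then show "cc.yd.rank = card \<B> + (m div p - 1)"
    using cc.simple_decomposition_conj_classes(2)[OF finA classA unionA]
    by (simp add: card_image[OF inj_diag_class] card_diag_exponents)
qed

section \<open>The summands as spans and the orders of the swaps\<close>

lemma diag_summand_eq: "diag_summand n \<theta> k = supported (diag_class k)"
proof -
  have "{rvec (diag_refl n \<theta> i k) | i. i < n} = rvec ` diag_class k"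
    by (auto simp: diag_class_def diag_refl_eq_dref)
  then show ?thesis unfolding diag_summand_def by (simp add: rvec_span)
qed

lemma swap_summand_eq: "swap_summand m n \<theta> = supported swap_reflections"
  by (simp add: swap_summand_def swap_refls_eq rvec_span)

text \<open>The order of \<open>k\<close> modulo \<open>m\<close> divides \<open>t\<close> if and only if \<open>m\<close> divides \<open>t k\<close>; for \<open>t = m/p\<close> this means
  that \<open>p\<close> divides \<open>k\<close>.\<close>

lemma exponents_of_order_iff:
  "(\<exists>d. d dvd m div p \<and> 1 < d \<and> k \<in> exponents_of_order m d) \<longleftrightarrow> k \<in> diag_exponents"
proof -
  have "m div gcd k m dvd m div p \<longleftrightarrow> p dvd k"
    using dvd_mult_iff_order_dvd[OF m_pos, of "m div p" k] theta_pow_quotient_iff[of k]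
    by (simp add: theta_pow_eq_1_iff mult.commute flip: power_mult)
  moreover have "1 < m div gcd k m \<longleftrightarrow> 0 < k" if "k < m"
  proof -
    have "m div gcd k m dvd 1 \<longleftrightarrow> k = 0"
      unfolding dvd_mult_iff_order_dvd[OF m_pos, of 1 k, symmetric] using that by (auto dest: dvd_imp_le)
    moreover have "m div gcd k m \<noteq> 0"
      using m_pos by (simp add: dvd_div_eq_0_iff)
    ultimately show ?thesis by (auto simp: less_Suc_eq)
  qed
  ultimately show ?thesis
    unfolding exponents_of_order_eq diag_exponents_def by auto
qed

lemma diag_summands_eq: "diag_summands m p n \<theta> = supported ` diag_class ` diag_exponents"
proof -
  have "(\<Union>d\<in>{d. d dvd m div p \<and> d > 1}. exponents_of_order m d) = diag_exponents"
    using exponents_of_order_iff by blast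
  then have "(\<Union>d\<in>{d. d dvd m div p \<and> d > 1}. supported ` diag_class ` exponents_of_order m d) =
      supported ` diag_class ` diag_exponents"
    by (metis image_UN)
  then show ?thesis
    by (simp add: diag_summands_def diag_summand_eq[abs_def] image_image)
qed

lemma V_parity_eq:
  assumes n: "n = 2" and m: "m = 2 * a"
  shows "V_even a \<theta> = supported (parity_class True)" "V_odd a \<theta> = supported (parity_class False)"
proof -
  have even_m: "even m" using m by simp
  have "parity_class e = {swap_refl 2 \<theta> 0 1 k | k. k < m \<and> (even k \<longleftrightarrow> e)}" for e
    using mu_exponent theta_pow_half[OF even_m]
    by (auto simp: parity_class_def swap_refl_eq_sref)
  then have parity: "rvec ` parity_class e = {rvec (swap_refl 2 \<theta> 0 1 k) | k. k < m \<and> (even k \<longleftrightarrow> e)}" for e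
    by auto
  have "{rvec (swap_refl 2 \<theta> 0 1 (2 * k)) | k. k < a} =
      {rvec (swap_refl 2 \<theta> 0 1 k) | k. k < m \<and> (even k \<longleftrightarrow> True)}"
    unfolding m by (auto elim!: evenE)
  then show "V_even a \<theta> = supported (parity_class True)"
    unfolding V_even_def by (simp only: rvec_span flip: parity)
  have "{rvec (swap_refl 2 \<theta> 0 1 (2 * k + 1)) | k. k < a} =
      {rvec (swap_refl 2 \<theta> 0 1 k) | k. k < m \<and> (even k \<longleftrightarrow> False)}"
  proof (intro equalityI subsetI)
    fix v assume "v \<in> {rvec (swap_refl 2 \<theta> 0 1 k) | k. k < m \<and> (even k \<longleftrightarrow> False)}"
    then obtain k where k: "k < m" "odd k" and v: "v = rvec (swap_refl 2 \<theta> 0 1 k)" by blast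
    then obtain h where "k = 2 * h + 1" by (elim oddE)
    then show "v \<in> {rvec (swap_refl 2 \<theta> 0 1 (2 * k + 1)) | k. k < a}"
      using k(1) v by (intro CollectI exI[of _ h]) (simp add: m)
  next
    fix v assume "v \<in> {rvec (swap_refl 2 \<theta> 0 1 (2 * k + 1)) | k. k < a}"
    then obtain k where "k < a" "v = rvec (swap_refl 2 \<theta> 0 1 (2 * k + 1))" by blast
    then show "v \<in> {rvec (swap_refl 2 \<theta> 0 1 k) | k. k < m \<and> (even k \<longleftrightarrow> False)}"
      by (intro CollectI exI[of _ "2 * k + 1"]) (simp add: m)
  qed
  then show "V_odd a \<theta> = supported (parity_class False)"
    unfolding V_odd_def by (simp only: rvec_span flip: parity)
qed

lemma ord_swap_reflection:
  assumes "s \<in> swap_reflections"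
  shows "ord s = 2"
proof -
  obtain i j z where s: "s = sref n i j z" and ij: "i < n" "j < n" "i \<noteq> j" and z: "z \<in> \<mu>"
    using assms unfolding swap_reflections_def by blast
  have mem: "s \<in> carrier G" unfolding s using ij z by (rule sref_carrier)
  have "s * s = monomial n id (\<lambda>_. 1)"
    unfolding s sref_def using ij mu_nonzero[OF z]
    by (subst monomial_mult) (auto simp: Transposition.transpose_def intro!: monomial_cong)
  moreover have "s [^]\<^bsub>G\<^esub> (2 :: nat) = s \<otimes>\<^bsub>G\<^esub> s"
    using mem by (simp add: numeral_2_eq_2 del: G_simps)
  ultimately have "s [^]\<^bsub>G\<^esub> (2 :: nat) = \<one>\<^bsub>G\<^esub>"
    by (simp add: monomial_one)
  then have "ord s dvd 2" using pow_eq_id[OF mem] by blast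
  moreover have "ord s \<noteq> 1" using ord_eq_1[OF mem] sref_ne_one[OF ij] by (simp add: s)
  ultimately show ?thesis using prime_nat_iff two_is_prime_nat by blast
qed

end

theorem lemma3p4:
  fixes \<theta> :: "'k::field_char_0" and m p n :: nat
  assumes "n \<ge> 2" and "m \<ge> 1" and "p dvd m"
    and "primitive_root_of_unity m \<theta>"
  shows "Y_is_yetter_drinfeld m p n \<theta>
    \<and> real (pm_dim (Y_space m p n \<theta>))
        = real n * (real m * ((real n - 1) / 2) + real m / real p - 1)
    \<and> (\<forall>s\<in>swap_refls m n \<theta>. group.ord (reflection_group m p n \<theta>) s = 2)
    \<and> (n \<ge> 3 \<or> (n = 2 \<and> odd p) \<longrightarrow>
         nichols_rank m p n \<theta> = m div p
       \<and> Y_simple_decomposition m p n \<theta> ({swap_summand m n \<theta>} \<union> diag_summands m p n \<theta>)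
       \<and> real (pm_dim (swap_summand m n \<theta>)) = real m * real n * (real n - 1) / 2
       \<and> (\<forall>d. d dvd m div p \<and> d > 1 \<longrightarrow>
            inj_on (diag_summand n \<theta>) (exponents_of_order m d)
          \<and> card (diag_summand n \<theta> ` exponents_of_order m d) = totient d
          \<and> (\<forall>k\<in>exponents_of_order m d. pm_dim (diag_summand n \<theta> k) = n)))
    \<and> (\<forall>a b. n = 2 \<and> p = 2 * b \<and> m = 2 * a \<longrightarrow>
         nichols_rank m p n \<theta> = a div b + 1
       \<and> Y_submodule m p n \<theta> (swap_summand m n \<theta>)
       \<and> Y_simple_submodule m p n \<theta> (V_odd a \<theta>)
       \<and> Y_simple_submodule m p n \<theta> (V_even a \<theta>)
       \<and> V_odd a \<theta> \<noteq> V_even a \<theta>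
       \<and> internal_direct_sum {V_odd a \<theta>, V_even a \<theta>} (swap_summand m n \<theta>)
       \<and> Y_simple_decomposition m p n \<theta> ({V_odd a \<theta>, V_even a \<theta>} \<union> diag_summands m p n \<theta>))"
proof -
  interpret imprimitive_reflection_group m p n \<theta>
    using assms by unfold_locales simp_all
  have swap_dim: "real (card swap_reflections) = real m * real n * (real n - 1) / 2"
  proof -
    have "real (2 * card swap_reflections) = real (m * (n * (n - 1)))"
      by (simp only: card_swap_reflections)
    then show ?thesis using n_ge_2 by (simp add: of_nat_diff)
  qed
  have quotient_pos: "1 \<le> m div p"
    using p_dvd_m p_pos m_pos by (auto elim!: dvdE)
  have "card S = n * (m div p - 1) + card swap_reflections"
    using card_Un_disjoint[OF finite_diag_reflections finite_swap_reflections diag_swap_disjoint]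
    by (simp add: reflections_eq card_diag_reflections)
  moreover have "real (m div p) = real m / real p" using p_dvd_m by (rule real_of_nat_div)
  ultimately have "real (card S) = real n * (real m / real p - 1) + real (card swap_reflections)"
    using quotient_pos by (simp add: of_nat_diff del: of_nat_div)
  then have dim: "real (card S) = real n * (real m * ((real n - 1) / 2) + real m / real p - 1)"
    by (simp add: swap_dim algebra_simps)
  have "finite S"
    unfolding reflections_eq using finite_diag_reflections finite_swap_reflections by simp
  then have part0: "Y_is_yetter_drinfeld m p n \<theta>"
    "real (pm_dim (Y_space m p n \<theta>)) = real n * (real m * ((real n - 1) / 2) + real m / real p - 1)"
    "\<forall>s\<in>swap_refls m n \<theta>. ord s = 2"
    using cc.yd.yetter_drinfeld_module_axioms dim
    by (simp_all add: Y_eqs dim_supported swap_refls_eq ord_swap_reflection)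
  have summand: "inj_on (diag_summand n \<theta>) (exponents_of_order m d) \<and>
      card (diag_summand n \<theta> ` exponents_of_order m d) = totient d \<and>
      (\<forall>k\<in>exponents_of_order m d. pm_dim (diag_summand n \<theta> k) = n)"
    if d: "d dvd m div p" "d > 1" for d
  proof -
    have sub: "exponents_of_order m d \<subseteq> diag_exponents" using exponents_of_order_iff d by blast
    have inj: "inj_on (diag_summand n \<theta>) (exponents_of_order m d)"
      using inj_diag_class sub by (auto simp: inj_on_def diag_summand_eq)
    have "d dvd m" using d(1) p_dvd_m by (metis dvd_mult_div_cancel dvd_mult)
    then have "card (diag_summand n \<theta> ` exponents_of_order m d) = totient d"
      using card_image[OF inj] card_exponents_of_order[OF m_pos _ d(2)] by simp
    moreover have "pm_dim (diag_summand n \<theta> k) = n" if "k \<in> exponents_of_order m d" for k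
      using card_diag_class[OF subsetD[OF sub that]] by (simp add: diag_summand_eq dim_supported diag_class_def)
    ultimately show ?thesis using inj by simp
  qed
  have one_class: "nichols_rank m p n \<theta> = m div p \<and>
      Y_simple_decomposition m p n \<theta> ({swap_summand m n \<theta>} \<union> diag_summands m p n \<theta>) \<and>
      real (pm_dim (swap_summand m n \<theta>)) = real m * real n * (real n - 1) / 2"
    if "n \<ge> 3 \<or> (n = 2 \<and> odd p)"
  proof -
    have cls: "cc.conj_class B" if "B \<in> {swap_reflections}" for B
      using conj_class_swap that \<open>n \<ge> 3 \<or> (n = 2 \<and> odd p)\<close> by auto
    note dec = simple_decomposition_of_swap_classes[of "{swap_reflections}", OF _ cls]
    show ?thesis
      using dec quotient_pos swap_dim finite_swap_reflections
      by (simp add: nichols_rank_def Y_eqs swap_summand_eq diag_summands_eq dim_supported)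
  qed
  have two_classes: "nichols_rank m p n \<theta> = a div b + 1
       \<and> Y_submodule m p n \<theta> (swap_summand m n \<theta>)
       \<and> Y_simple_submodule m p n \<theta> (V_odd a \<theta>)
       \<and> Y_simple_submodule m p n \<theta> (V_even a \<theta>)
       \<and> V_odd a \<theta> \<noteq> V_even a \<theta>
       \<and> internal_direct_sum {V_odd a \<theta>, V_even a \<theta>} (swap_summand m n \<theta>)
       \<and> Y_simple_decomposition m p n \<theta> ({V_odd a \<theta>, V_even a \<theta>} \<union> diag_summands m p n \<theta>)"
    if "n = 2 \<and> p = 2 * b \<and> m = 2 * a" for a b
  proof -
    have n: "n = 2" and p: "even p" and m: "m = 2 * a" and quotient: "m div p = a div b"
      using that by simp_all
    let ?B = "{parity_class False, parity_class True}"
    have cls: "cc.conj_class B" if "B \<in> ?B" for B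
      using conj_class_parity[OF n p] that by auto
    have union: "\<Union>?B = swap_reflections" using swap_reflections_parity[OF n] by auto
    note disj = parity_class_disjoint[OF n]
    have ne: "parity_class False \<noteq> parity_class True"
      using disj cls[of "parity_class True"] by (auto simp: cc.conj_class_def)
    note dec = simple_decomposition_of_swap_classes[of ?B, OF _ cls union]
    have "internal_direct_sum (supported ` ?B) (supported (\<Union>?B) :: ('k mat \<Rightarrow>\<^sub>0 'k) set)"
      using disj by (intro internal_direct_sum_supported) auto
    then have sum: "internal_direct_sum {V_odd a \<theta>, V_even a \<theta>} (swap_summand m n \<theta>)"
      unfolding union by (simp add: V_parity_eq[OF n m] swap_summand_eq)
    have "\<forall>g\<in>carrier G. \<forall>s\<in>swap_reflections. cc.conj g s \<in> swap_reflections"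
    proof (intro ballI)
      fix g s assume g: "g \<in> carrier G" and "s \<in> swap_reflections"
      then obtain B where B: "B \<in> ?B" "s \<in> B" using union by blast
      then have "cc.conj g s \<in> B" using cc.conj_class_stable[OF cls[OF B(1)]] g by simp
      then show "cc.conj g s \<in> swap_reflections" using B(1) union by blast
    qed
    then have sub: "cc.yd.submodule (supported swap_reflections)"
      unfolding cc.submodule_iff by (intro exI[of _ swap_reflections]) (simp add: reflections_eq)
    show ?thesis
      using dec ne sum sub quotient quotient_pos cls[THEN cc.simple_supported_conj_class]
      by (simp add: nichols_rank_def Y_eqs V_parity_eq[OF n m] swap_summand_eq diag_summands_eq)
  qed
  show ?thesis
    using part0 summand one_class two_classes by blast
qed

end
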